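(* Fix any integer $n\geq 1$. For integers $a_1<a_2<\cdots<a_n$ let $\chi(x)=(x-a_1)\cdots(x-a_n)$, $R=\mathbb{Z}[x]/(\chi(x))$ and $\Delta=\prod_{1\le i<j\le n}(a_j-a_i)$. Then $$\lim_{\Delta\to \infty}\frac{|\mathrm{ICM}(R)|\cdot 2^{n-1}}{\Delta}=1,$$ that is, for every $\varepsilon>0$ there is $N$ such that for all integers $a_1<\cdots<a_n$ with $\Delta\ge N$ one has $\left|\frac{|\mathrm{ICM}(R)|\cdot 2^{n-1}}{\Delta}-1\right|<\varepsilon$.
   Context: Put $K=\mathbb{Q}\otimes_{\mathbb{Z}}R\cong\mathbb{Q}[x]/(\chi(x))$. A fractional $R$-ideal is an $R$-submodule $I\subset K$ that is a free $\mathbb{Z}$-module of rank $n$. Fractional ideals are multiplied in the usual way. Two fractional $R$-ideals $I,J$ are equivalent if $I=kJ$ for some $k\in K^\times$. The ideal class monoid $\mathrm{ICM}(R)$ is the monoid of equivalence classes of fractional $R$-ideals. For $n=1$ the empty product gives $\Delta=1$, so the limit statement is vacuous in that case. *)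

theory Defs
  imports
    "HOL-Algebra.Algebraic_Closure_Type"
    "HOL-Algebra.Free_Abelian_Groups"
    "HOL-Algebra.Ideal_Product"
    "HOL-Computational_Algebra.Polynomial"
begin

definition chi :: "nat \<Rightarrow> (nat \<Rightarrow> int) \<Rightarrow> int poly" where
  "chi n a = (\<Prod>i\<in>{1..n}. [:- a i, 1:])"

definition Delta :: "nat \<Rightarrow> (nat \<Rightarrow> int) \<Rightarrow> int" where
  "Delta n a = (\<Prod>(i, j)\<in>{(i, j). 1 \<le> i \<and> i < j \<and> j \<le> n}. a j - a i)"

text \<open>
  In what follows \<open>f\<close> is a monic integer polynomial,
  \<open>ZX_mod f\<close> is \<open>R = \<int>[x]/(f)\<close> and \<open>QX_mod f\<close> is \<open>K = \<rat>[x]/(f)\<close>.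
\<close>

definition ZX_mod :: "int poly \<Rightarrow> int poly set ring" where
  "ZX_mod f = ring_of_type_algebra Quot (PIdl\<^bsub>ring_of_type_algebra\<^esub> f)"

definition QX_ideal :: "int poly \<Rightarrow> rat poly set" where
  "QX_ideal f = PIdl\<^bsub>ring_of_type_algebra\<^esub> (map_poly of_int f)"

text \<open>
  The ring homomorphism \<open>R \<rightarrow> K\<close> induced by \<open>\<int>[x] \<subseteq> \<rat>[x]\<close>. All members of a residue class
  \<open>A\<close> modulo \<open>f\<close> give the same coset, so the union is just that coset.
\<close>

definition ZX_to_QX :: "int poly \<Rightarrow> int poly set \<Rightarrow> rat poly set" where
  "ZX_to_QX f A = (\<Union>p\<in>A. QX_ideal f +>\<^bsub>ring_of_type_algebra\<^esub> map_poly of_int p)"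

text \<open>The ring \<open>K\<close> together with its scalar multiplication by \<open>R\<close>.\<close>

definition QX_mod :: "int poly \<Rightarrow> (int poly set, rat poly set) module" where
  "QX_mod f =
     (let K = ring_of_type_algebra Quot QX_ideal f
      in ring.extend K (module.fields (\<lambda>A y. ZX_to_QX f A \<otimes>\<^bsub>K\<^esub> y)))"

text \<open>The second conjunct says that \<open>I\<close> is a free \<open>\<int>\<close>-module of rank \<open>degree f\<close>.\<close>

definition fractional_ideal :: "int poly \<Rightarrow> rat poly set set \<Rightarrow> bool" where
  "fractional_ideal f I \<longleftrightarrow>
     submodule I (ZX_mod f) (QX_mod f) \<and>
     (add_monoid (QX_mod f))\<lparr>carrier := I\<rparr> \<cong> free_Abelian_group {..<Polynomial.degree f}"

definition fractional_ideal_equiv :: "int poly \<Rightarrow> (rat poly set set \<times> rat poly set set) set" where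
  "fractional_ideal_equiv f =
     {(I, J). fractional_ideal f I \<and> fractional_ideal f J \<and>
        (\<exists>k\<in>Units (QX_mod f). I = k <#\<^bsub>QX_mod f\<^esub> J)}"

text \<open>
  The library's \<^const>\<open>ideal_prod\<close> does not require its arguments to be ideals of the ring; for
  submodules \<open>I\<close>, \<open>J\<close> of \<open>K\<close> it is the set of all finite sums of products \<open>x y\<close> with
  \<open>x \<in> I\<close> and \<open>y \<in> J\<close>. The neutral class is that of the image of \<open>R\<close> in \<open>K\<close>.
\<close>

definition ICM :: "int poly \<Rightarrow> rat poly set set set monoid" where
  "ICM f =
     \<lparr>carrier = {I. fractional_ideal f I} // fractional_ideal_equiv f,
      monoid.mult = (\<lambda>A B. \<Union>I\<in>A. \<Union>J\<in>B. fractional_ideal_equiv f `` {I \<cdot>\<^bsub>QX_mod f\<^esub> J}),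
      one = fractional_ideal_equiv f `` {ZX_to_QX f ` carrier (ZX_mod f)}\<rparr>"

end

theory Submission
  imports Defs
begin

text \<open>
  Evaluation at the roots identifies \<open>K\<close> with \<open>\<rat>\<^sup>n\<close>. The residue class of \<open>x\<close> then acts as the
  diagonal matrix \<open>A\<close> with entries \<open>a\<^sub>1, \<dots>, a\<^sub>n\<close>, fractional ideals become the lattices of rank \<open>n\<close>
  that are stable under \<open>A\<close>, and equivalence becomes scaling by an invertible diagonal matrix.
  Intersecting such a lattice with the coordinate flag gives it a basis whose vectors are the columns
  of an upper triangular matrix \<open>P\<close>, and then \<open>A P = P T\<close> for an integer upper triangular matrix \<open>T\<close>
  with diagonal \<open>a\<close>, the type of the lattice. Every \<open>T\<close> occurs, because \<open>P\<close> can be solved for entry by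
  entry, and two lattices are equivalent iff \<open>T g = g T'\<close> for some integer upper triangular \<open>g\<close> with
  diagonal entries \<open>\<plusminus>1\<close> (\<open>scale_equivalent_iff_conj\<close>). So the ideal classes are the orbits of these
  \<open>g\<close> on the matrices \<open>T\<close>, as in the theorem of Latimer and MacDuffee.

  The equation \<open>T g = g T'\<close> reads, at the entry \<open>(i, j)\<close>,
  \<open>g\<^sub>i\<^sub>i T'\<^sub>i\<^sub>j + (a\<^sub>j - a\<^sub>i) g\<^sub>i\<^sub>j = g\<^sub>j\<^sub>j T\<^sub>i\<^sub>j + \<dots>\<close>, where the dots involve only entries closer to the
  diagonal. Hence, for a prescribed diagonal \<open>s\<close> of \<open>g\<close>, division with remainder yields exactly one
  \<open>T'\<close> with \<open>0 \<le> T'\<^sub>i\<^sub>j < a\<^sub>j - a\<^sub>i\<close> (\<open>normal_form_exists\<close>, \<open>normal_form_unique\<close>). There are \<open>\<Delta>\<close> such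
  reduced matrices, and an ideal class consists of the normal forms of one of them under the sign
  vectors \<open>s\<close>. Since \<open>g\<close> and \<open>-g\<close> have the same effect, \<open>s\<^sub>1 = 1\<close> may be assumed, so a class contains
  at most \<open>2\<^bsup>n-1\<^esup>\<close> reduced matrices, and exactly that many unless two sign vectors \<open>s \<noteq> s'\<close> give the
  same normal form.

  Such collisions are rare. If \<open>s\<close> and \<open>s'\<close> collide on \<open>T\<close>, then for every pair \<open>i < j\<close> with
  \<open>s\<^sub>i s\<^sub>j \<noteq> s'\<^sub>i s'\<^sub>j\<close> the two equations together determine \<open>2 T\<^sub>i\<^sub>j\<close> modulo \<open>a\<^sub>j - a\<^sub>i\<close> from the entries
  closer to the diagonal, which leaves two values for \<open>T\<^sub>i\<^sub>j\<close> instead of \<open>a\<^sub>j - a\<^sub>i\<close>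
  (\<open>collision_determined\<close>). One of these pairs satisfies \<open>2 (a\<^sub>j - a\<^sub>i) \<ge> a\<^sub>n - a\<^sub>1\<close>
  (\<open>wide_separating_pair\<close>), so the collisions make up a proportion of order \<open>1 / (a\<^sub>n - a\<^sub>1)\<close> of all
  reduced matrices. Finally \<open>a\<^sub>n - a\<^sub>1\<close> tends to infinity with \<open>\<Delta>\<close>, because \<open>\<Delta>\<close> is at most a fixed
  power of it.
\<close>

section \<open>Integer upper triangular matrices up to triangular conjugation\<close>

text \<open>
  The product of upper triangular matrices, that is, of the incidence algebra of \<open>(\<nat>, \<le>)\<close>. Entries
  below the diagonal never enter, so matrices need not vanish there, and no size has to be fixed.
\<close>

definition tri_mult :: "(nat \<Rightarrow> nat \<Rightarrow> 'a) \<Rightarrow> (nat \<Rightarrow> nat \<Rightarrow> 'a) \<Rightarrow> nat \<Rightarrow> nat \<Rightarrow> 'a::comm_ring_1"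
    (infixl \<open>\<diamondop>\<close> 70) where
  "(A \<diamondop> B) i j = (\<Sum>l\<in>{i..j}. A i l * B l j)"

lemma tri_mult_assoc: "((A \<diamondop> B) \<diamondop> C) i j = (A \<diamondop> (B \<diamondop> C)) i j"
proof -
  have "((A \<diamondop> B) \<diamondop> C) i j = (\<Sum>l\<in>{i..j}. \<Sum>m\<in>{i..l}. A i m * B m l * C l j)"
    by (simp add: tri_mult_def sum_distrib_right)
  also have "\<dots> = (\<Sum>(l, m)\<in>(SIGMA l:{i..j}. {i..l}). A i m * B m l * C l j)"
    by (simp add: sum.Sigma)
  also have "\<dots> = (\<Sum>(m, l)\<in>(SIGMA m:{i..j}. {m..j}). A i m * B m l * C l j)"
    by (rule sum.reindex_bij_witness[of _ prod.swap prod.swap]) auto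
  also have "\<dots> = (\<Sum>m\<in>{i..j}. \<Sum>l\<in>{m..j}. A i m * B m l * C l j)"
    by (simp add: sum.Sigma)
  also have "\<dots> = (A \<diamondop> (B \<diamondop> C)) i j"
    by (simp add: tri_mult_def sum_distrib_left mult.assoc)
  finally show ?thesis .
qed

lemma tri_mult_diag [simp]: "(A \<diamondop> B) i i = A i i * B i i"
  by (simp add: tri_mult_def)

lemma tri_mult_expand:
  assumes "i < j"
  shows "(A \<diamondop> B) i j = A i i * B i j + A i j * B j j + (\<Sum>l\<in>{i<..<j}. A i l * B l j)"
proof -
  have "{i..j} = insert i (insert j {i<..<j})" using assms by auto
  then show ?thesis using assms by (simp add: tri_mult_def)
qed

lemma tri_mult_cong:
  assumes "\<And>l. i \<le> l \<Longrightarrow> l \<le> j \<Longrightarrow> A i l = A' i l" "\<And>l. i \<le> l \<Longrightarrow> l \<le> j \<Longrightarrow> B l j = B' l j"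
  shows "(A \<diamondop> B) i j = (A' \<diamondop> B') i j"
  using assms by (simp add: tri_mult_def)

text \<open>
  Triangular equations are solved diagonal by diagonal: the entry \<open>(i, j)\<close> may be chosen once all
  entries with a smaller difference \<open>j - i\<close> are known.
\<close>

lemma entrywise_recursion:
  fixes Q :: "(nat \<Rightarrow> nat \<Rightarrow> 'a) \<Rightarrow> nat \<Rightarrow> nat \<Rightarrow> 'a \<Rightarrow> bool"
  assumes adm: "\<And>f g i j x. (\<And>k l. l - k < j - i \<Longrightarrow> f k l = g k l) \<Longrightarrow> Q f i j x = Q g i j x"
    and ex: "\<And>f i j. \<exists>x. Q f i j x"
  shows "\<exists>f. \<forall>i j. Q f i j (f i j)"
proof -
  have "\<exists>f. \<forall>x. (\<lambda>f x r. Q (curry f) (fst x) (snd x) r) f x (f x)"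
  proof (rule dependent_wf_choice)
    show "wf (measure (\<lambda>(i, j). j - i :: nat))" by simp
    show "Q (curry f) (fst x) (snd x) r = Q (curry g) (fst x) (snd x) r"
      if "\<And>z. (z, x) \<in> measure (\<lambda>(i, j). j - i) \<Longrightarrow> f z = g z" for f g x r
      by (rule adm) (use that in \<open>auto simp: case_prod_beta\<close>)
    show "\<exists>r. Q (curry f) (fst x) (snd x) r" for f x by (rule ex)
  qed
  then obtain f where f: "\<And>x. Q (curry f) (fst x) (snd x) (f x)" by blast
  show ?thesis
  proof (intro exI allI)
    show "Q (curry f) i j (curry f i j)" for i j using f[of "(i, j)"] by simp
  qed
qed

lemma entrywise_induct [consumes 3, case_names less]:
  assumes "1 \<le> i" "i < j" "j \<le> n"
    and "\<And>i j :: nat. 1 \<le> i \<Longrightarrow> i < j \<Longrightarrow> j \<le> n \<Longrightarrow>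
      (\<And>k l. 1 \<le> k \<Longrightarrow> k < l \<Longrightarrow> l \<le> n \<Longrightarrow> l - k < j - i \<Longrightarrow> R k l) \<Longrightarrow> R i j"
  shows "R i j"
  using assms(1-3)
proof (induction "j - i" arbitrary: i j rule: less_induct)
  case less
  show ?case
    by (rule assms(4)) (use less in auto)
qed

definition sign_vector :: "nat \<Rightarrow> (nat \<Rightarrow> int) \<Rightarrow> bool" where
  "sign_vector n s \<longleftrightarrow> (\<forall>i\<in>{1..n}. s i = 1 \<or> s i = - 1)"

lemma sign_vectorD: "sign_vector n s \<Longrightarrow> 1 \<le> i \<Longrightarrow> i \<le> n \<Longrightarrow> s i = 1 \<or> s i = - 1"
  by (auto simp: sign_vector_def)

text \<open>
  When the diagonal of \<open>g\<close> consists of signs, \<open>g\<close> is invertible over \<open>\<int>\<close> and this says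
  \<open>T' = g\<^sup>-\<^sup>1 T g\<close>; the form chosen here avoids inverses.
\<close>

definition conj_via :: "nat \<Rightarrow> (nat \<Rightarrow> nat \<Rightarrow> int) \<Rightarrow> (nat \<Rightarrow> nat \<Rightarrow> int) \<Rightarrow> (nat \<Rightarrow> nat \<Rightarrow> int) \<Rightarrow> bool" where
  "conj_via n T g T' \<longleftrightarrow> (\<forall>i j. 1 \<le> i \<longrightarrow> i \<le> j \<longrightarrow> j \<le> n \<longrightarrow> (T \<diamondop> g) i j = (g \<diamondop> T') i j)"

definition has_diag :: "nat \<Rightarrow> (nat \<Rightarrow> int) \<Rightarrow> (nat \<Rightarrow> nat \<Rightarrow> int) \<Rightarrow> bool" where
  "has_diag n a T \<longleftrightarrow> (\<forall>i\<in>{1..n}. T i i = a i)"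

text \<open>
  The entries outside the triangle \<open>1 \<le> i \<le> j \<le> n\<close> carry no information. They are fixed, so that a
  reduced matrix is determined by its entries above the diagonal and the set is finite.
\<close>

definition reduced :: "nat \<Rightarrow> (nat \<Rightarrow> int) \<Rightarrow> (nat \<Rightarrow> nat \<Rightarrow> int) set" where
  "reduced n a = {T. \<forall>i j. T i j \<in>
     (if 1 \<le> i \<and> i < j \<and> j \<le> n then {0..<a j - a i} else if i = j then {a i} else {0})}"

lemma reduced_has_diag: "T \<in> reduced n a \<Longrightarrow> has_diag n a T"
  by (fastforce simp: reduced_def has_diag_def split: if_splits)

lemma reduced_bounds:
  assumes "T \<in> reduced n a" "1 \<le> i" "i < j" "j \<le> n"
  shows "0 \<le> T i j" "T i j < a j - a i"
proof -
  have "T i j \<in> {0..<a j - a i}" using assms by (fastforce simp: reduced_def split: if_splits)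
  then show "0 \<le> T i j" "T i j < a j - a i" by auto
qed

lemma reduced_eqI:
  assumes "T \<in> reduced n a" "T' \<in> reduced n a"
    and eq: "\<And>i j. 1 \<le> i \<Longrightarrow> i < j \<Longrightarrow> j \<le> n \<Longrightarrow> T i j = T' i j"
  shows "T = T'"
proof (intro ext)
  fix i j
  show "T i j = T' i j"
  proof (cases "1 \<le> i \<and> i < j \<and> j \<le> n")
    case False
    then show ?thesis
      using assms(1,2)[unfolded reduced_def mem_Collect_eq, rule_format, of i j]
      by (simp split: if_splits)
  qed (use eq in auto)
qed

text \<open>
  The recursive form of conjugacy: since \<open>T\<close> and \<open>T'\<close> share their diagonal, \<open>g\<^sub>i\<^sub>j\<close> enters with the
  coefficient \<open>a\<^sub>j - a\<^sub>i\<close>, and everything under the sum lies closer to the diagonal.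
\<close>

lemma conj_via_iff:
  assumes "has_diag n a T" "has_diag n a T'"
  shows "conj_via n T g T' \<longleftrightarrow> (\<forall>i j. 1 \<le> i \<longrightarrow> i < j \<longrightarrow> j \<le> n \<longrightarrow>
    g i i * T' i j + (a j - a i) * g i j =
      g j j * T i j + (\<Sum>l\<in>{i<..<j}. T i l * g l j - g i l * T' l j))" (is "_ \<longleftrightarrow> ?rhs")
proof -
  have key: "(T \<diamondop> g) i j = (g \<diamondop> T') i j \<longleftrightarrow> g i i * T' i j + (a j - a i) * g i j =
      g j j * T i j + (\<Sum>l\<in>{i<..<j}. T i l * g l j - g i l * T' l j)"
    if "1 \<le> i" "i < j" "j \<le> n" for i j
  proof -
    have "T i i = a i" "T' j j = a j" using assms that by (auto simp: has_diag_def)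
    then show ?thesis using that
      by (auto simp: tri_mult_expand sum_subtractf algebra_simps)
  qed
  have "(T \<diamondop> g) i i = (g \<diamondop> T') i i" if "1 \<le> i" "i \<le> n" for i
    using assms that by (auto simp: has_diag_def)
  then have "conj_via n T g T' \<longleftrightarrow>
      (\<forall>i j. 1 \<le> i \<longrightarrow> i < j \<longrightarrow> j \<le> n \<longrightarrow> (T \<diamondop> g) i j = (g \<diamondop> T') i j)"
    unfolding conj_via_def by (auto simp: le_less)
  also have "\<dots> \<longleftrightarrow> ?rhs" using key by auto
  finally show ?thesis .
qed

lemma bounded_multiple_zero:
  fixes x y d :: int
  assumes "x = d * y" "\<bar>x\<bar> < d"
  shows "x = 0" "y = 0"
proof -
  have "d dvd x" using assms by simp
  then show "x = 0" using assms zdvd_imp_le[of d "\<bar>x\<bar>"] by fastforce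
  then show "y = 0" using assms by auto
qed

locale increasing_roots =
  fixes n :: nat and a :: "nat \<Rightarrow> int"
  assumes increasing: "strict_mono_on {1..n} a"
begin

lemma gap_pos: "1 \<le> i \<Longrightarrow> i < j \<Longrightarrow> j \<le> n \<Longrightarrow> 0 < a j - a i"
  using strict_mono_onD[OF increasing, of i j] by auto

text \<open>
  At each entry the right-hand side \<open>r\<close> of the recursive equation is known; division of \<open>s\<^sub>i r\<close> by
  \<open>a\<^sub>j - a\<^sub>i\<close> gives the entry of \<open>T'\<close> as the remainder and that of \<open>g\<close>, up to the sign \<open>s\<^sub>i\<close>, as the
  quotient.
\<close>

lemma normal_form_exists:
  assumes T: "has_diag n a T" and s: "sign_vector n s"
  shows "\<exists>g T'. T' \<in> reduced n a \<and> (\<forall>i\<in>{1..n}. g i i = s i) \<and> conj_via n T g T'"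
proof -
  \<comment> \<open>\<open>f i j\<close> holds the two unknown entries \<open>(g i j, T' i j)\<close>.\<close>
  define Q where "Q f i j x \<longleftrightarrow>
    (if 1 \<le> i \<and> i < j \<and> j \<le> n then
       s i * snd x + (a j - a i) * fst x =
         s j * T i j + (\<Sum>l\<in>{i<..<j}. T i l * fst (f l j) - fst (f i l) * snd (f l j))
       \<and> snd x \<in> {0..<a j - a i}
     else fst x = (if i = j then s i else 0) \<and> snd x = (if i = j then a i else 0))"
    for f :: "nat \<Rightarrow> nat \<Rightarrow> int \<times> int" and i j x
  have "\<exists>f. \<forall>i j. Q f i j (f i j)"
  proof (rule entrywise_recursion)
    fix f g :: "nat \<Rightarrow> nat \<Rightarrow> int \<times> int" and i j x
    assume eq: "\<And>k l. l - k < j - i \<Longrightarrow> f k l = g k l"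
    have "(\<Sum>l\<in>{i<..<j}. T i l * fst (f l j) - fst (f i l) * snd (f l j)) =
      (\<Sum>l\<in>{i<..<j}. T i l * fst (g l j) - fst (g i l) * snd (g l j))"
    proof (rule sum.cong)
      fix l assume "l \<in> {i<..<j}"
      then have "f l j = g l j" "f i l = g i l" by (auto intro!: eq)
      then show "T i l * fst (f l j) - fst (f i l) * snd (f l j) =
        T i l * fst (g l j) - fst (g i l) * snd (g l j)" by simp
    qed simp
    then show "Q f i j x = Q g i j x" by (simp add: Q_def)
  next
    fix f i j
    show "\<exists>x. Q f i j x"
    proof (cases "1 \<le> i \<and> i < j \<and> j \<le> n")
      case True
      define d where "d = a j - a i"
      define r where "r = s j * T i j + (\<Sum>l\<in>{i<..<j}. T i l * fst (f l j) - fst (f i l) * snd (f l j))"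
      have "d > 0" using gap_pos True by (auto simp: d_def)
      have si: "s i * s i = 1" using sign_vectorD[OF s, of i] True by auto
      have "s i * ((s i * r) mod d) + d * (s i * ((s i * r) div d)) =
          s i * (d * ((s i * r) div d) + (s i * r) mod d)"
        by (simp only: distrib_left mult.left_commute add.commute)
      also have "\<dots> = r" using si by (simp only: mult_div_mod_eq flip: mult.assoc)
      finally have eq: "s i * ((s i * r) mod d) + d * (s i * ((s i * r) div d)) = r" .
      have "Q f i j (s i * ((s i * r) div d), (s i * r) mod d)"
        using True \<open>d > 0\<close> eq by (simp add: Q_def flip: d_def r_def)
      then show ?thesis by blast
    next
      case False
      then show ?thesis
        by (intro exI[of _ "((if i = j then s i else 0), (if i = j then a i else 0))"]) (auto simp: Q_def)
    qed
  qed
  then obtain f where f: "\<And>i j. Q f i j (f i j)" by blast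
  define g T' where "g = (\<lambda>i j. fst (f i j))" and "T' = (\<lambda>i j. snd (f i j))"
  have red: "T' \<in> reduced n a"
    unfolding reduced_def
  proof (intro CollectI allI)
    show "T' i j \<in> (if 1 \<le> i \<and> i < j \<and> j \<le> n then {0..<a j - a i}
        else if i = j then {a i} else {0})" for i j
      using f[of i j] unfolding Q_def T'_def by (cases "1 \<le> i \<and> i < j \<and> j \<le> n") auto
  qed
  have dg: "\<And>i. g i i = s i" using f by (simp add: Q_def g_def)
  have "conj_via n T g T'"
    unfolding conj_via_iff[OF T reduced_has_diag[OF red]]
    using f dg by (auto simp: Q_def g_def T'_def)
  with red dg show ?thesis by blast
qed

text \<open>
  Remainder and quotient are unique, so \<open>T'\<close> and \<open>g\<close> are determined entry by entry.
\<close>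

lemma normal_form_unique:
  assumes T: "has_diag n a T" and s: "sign_vector n s"
    and U: "U \<in> reduced n a" "\<forall>i\<in>{1..n}. g i i = s i" "conj_via n T g U"
    and V: "V \<in> reduced n a" "\<forall>i\<in>{1..n}. h i i = s i" "conj_via n T h V"
  shows "U = V"
proof (rule reduced_eqI[OF U(1) V(1)])
  fix i j assume "1 \<le> i" "i < j" "j \<le> n"
  then have "U i j = V i j \<and> g i j = h i j"
  proof (induction rule: entrywise_induct)
    case (less i j)
    define d where "d = a j - a i"
    have ij: "i \<in> {1..n}" "j \<in> {1..n}" using less by auto
    have "s i * U i j + d * g i j = s j * T i j + (\<Sum>l\<in>{i<..<j}. T i l * g l j - g i l * U l j)"
      using U less(1-3) ij unfolding conj_via_iff[OF T reduced_has_diag[OF U(1)]] by (auto simp: d_def)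
    also have "(\<Sum>l\<in>{i<..<j}. T i l * g l j - g i l * U l j) =
        (\<Sum>l\<in>{i<..<j}. T i l * h l j - h i l * V l j)"
      by (intro sum.cong) (use less in auto)
    also have "s j * T i j + \<dots> = s i * V i j + d * h i j"
      using V less(1-3) ij unfolding conj_via_iff[OF T reduced_has_diag[OF V(1)]] by (auto simp: d_def)
    finally have eq: "s i * U i j + d * g i j = s i * V i j + d * h i j" .
    have b: "\<bar>U i j - V i j\<bar> < d"
      using reduced_bounds[OF U(1) less(1-3)] reduced_bounds[OF V(1) less(1-3)] by (auto simp: d_def)
    have "s i = 1 \<or> s i = -1" using s ij by (auto simp: sign_vector_def)
    then have "s i * (U i j - V i j) = d * (h i j - g i j)" "\<bar>s i * (U i j - V i j)\<bar> < d"
      using eq b by (auto simp: algebra_simps)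
    from bounded_multiple_zero[OF this] \<open>s i = 1 \<or> s i = -1\<close> show ?case by auto
  qed
  then show "U i j = V i j" by simp
qed

text \<open>
  For sign vectors this means that \<open>T\<close> commutes with a triangular integer matrix whose diagonal
  is \<open>s s'\<close>. The form with a common conjugate \<open>U\<close> allows both recursive equations to be compared without forming a quotient
  of \<open>g\<close> and \<open>g'\<close>.
\<close>

definition collides :: "(nat \<Rightarrow> int) \<Rightarrow> (nat \<Rightarrow> int) \<Rightarrow> (nat \<Rightarrow> nat \<Rightarrow> int) \<Rightarrow> bool" where
  "collides s s' T \<longleftrightarrow> (\<exists>U g g'. U \<in> reduced n a \<and>
     (\<forall>i\<in>{1..n}. g i i = s i) \<and> conj_via n T g U \<and> (\<forall>i\<in>{1..n}. g' i i = s' i) \<and> conj_via n T g' U)"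

text \<open>
  Multiplying the recursive equation for \<open>s\<close> by \<open>s\<^sub>i\<close> and that for \<open>s'\<close> by \<open>s'\<^sub>i\<close> and subtracting
  eliminates \<open>U\<^sub>i\<^sub>j\<close>. What remains is \<open>(s\<^sub>i s\<^sub>j - s'\<^sub>i s'\<^sub>j) T\<^sub>i\<^sub>j\<close> modulo \<open>a\<^sub>j - a\<^sub>i\<close>, where the coefficient is
  \<open>0\<close> or \<open>\<plusminus>2\<close>. In the second case \<open>2 T\<^sub>i\<^sub>j\<close> is known modulo \<open>a\<^sub>j - a\<^sub>i\<close>, and the half of the interval
  that contains \<open>T\<^sub>i\<^sub>j\<close> settles the rest.
\<close>

lemma collision_determined:
  assumes s: "sign_vector n s" "sign_vector n s'"
    and T: "T \<in> reduced n a" "collides s s' T" and S: "S \<in> reduced n a" "collides s s' S"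
    and same: "\<And>i j. 1 \<le> i \<Longrightarrow> i < j \<Longrightarrow> j \<le> n \<Longrightarrow> s i * s j = s' i * s' j \<Longrightarrow> T i j = S i j"
    and half: "\<And>i j. 1 \<le> i \<Longrightarrow> i < j \<Longrightarrow> j \<le> n \<Longrightarrow> s i * s j \<noteq> s' i * s' j \<Longrightarrow>
       2 * T i j < a j - a i \<longleftrightarrow> 2 * S i j < a j - a i"
  shows "T = S"
proof -
  obtain U g g' where U: "U \<in> reduced n a" "\<forall>i\<in>{1..n}. g i i = s i" "conj_via n T g U"
      "\<forall>i\<in>{1..n}. g' i i = s' i" "conj_via n T g' U"
    using T(2) unfolding collides_def by blast
  obtain V h h' where V: "V \<in> reduced n a" "\<forall>i\<in>{1..n}. h i i = s i" "conj_via n S h V"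
      "\<forall>i\<in>{1..n}. h' i i = s' i" "conj_via n S h' V"
    using S(2) unfolding collides_def by blast
  note iffT = conj_via_iff[OF reduced_has_diag[OF T(1)] reduced_has_diag[OF U(1)]]
  note iffS = conj_via_iff[OF reduced_has_diag[OF S(1)] reduced_has_diag[OF V(1)]]
  show "T = S"
  proof (rule reduced_eqI[OF T(1) S(1)])
    fix i j assume "1 \<le> i" "i < j" "j \<le> n"
    then have "T i j = S i j \<and> U i j = V i j \<and> g i j = h i j \<and> g' i j = h' i j"
    proof (induction rule: entrywise_induct)
      case (less i j)
      define d where "d = a j - a i"
      have ij: "i \<in> {1..n}" "j \<in> {1..n}" using less by auto
      have near: "T i l = S i l" "g l j = h l j" "g' l j = h' l j" "g i l = h i l" "g' i l = h' i l"
          "U l j = V l j" if "l \<in> {i<..<j}" for l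
        using less.IH[of i l] less.IH[of l j] that less(1-3) by auto
      have sums: "(\<Sum>l\<in>{i<..<j}. T i l * g l j - g i l * U l j) =
          (\<Sum>l\<in>{i<..<j}. S i l * h l j - h i l * V l j)"
        "(\<Sum>l\<in>{i<..<j}. T i l * g' l j - g' i l * U l j) =
          (\<Sum>l\<in>{i<..<j}. S i l * h' l j - h' i l * V l j)"
        by (intro sum.cong refl; simp add: near)+
      have eqs: "s i * U i j + d * g i j = s j * T i j + (\<Sum>l\<in>{i<..<j}. T i l * g l j - g i l * U l j)"
        "s i * V i j + d * h i j = s j * S i j + (\<Sum>l\<in>{i<..<j}. S i l * h l j - h i l * V l j)"
        "s' i * U i j + d * g' i j = s' j * T i j + (\<Sum>l\<in>{i<..<j}. T i l * g' l j - g' i l * U l j)"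
        "s' i * V i j + d * h' i j = s' j * S i j + (\<Sum>l\<in>{i<..<j}. S i l * h' l j - h' i l * V l j)"
        using U V less(1-3) ij unfolding iffT iffS by (auto simp: d_def)
      have bU: "\<bar>U i j - V i j\<bar> < d" and bT: "0 \<le> T i j" "T i j < d" "0 \<le> S i j" "S i j < d"
        using reduced_bounds[OF U(1) less(1-3)] reduced_bounds[OF V(1) less(1-3)]
          reduced_bounds[OF T(1) less(1-3)] reduced_bounds[OF S(1) less(1-3)] by (auto simp: d_def)
      have d1: "s i * (U i j - V i j) + d * (g i j - h i j) = s j * (T i j - S i j)"
        and d2: "s' i * (U i j - V i j) + d * (g' i j - h' i j) = s' j * (T i j - S i j)"
        using eqs sums by (auto simp: algebra_simps)
      have signs: "s i = 1 \<or> s i = -1" "s j = 1 \<or> s j = -1" "s' i = 1 \<or> s' i = -1" "s' j = 1 \<or> s' j = -1"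
        using s ij by (auto simp: sign_vector_def)
      have TS: "T i j = S i j"
      proof (cases "s i * s j = s' i * s' j")
        case True
        then show ?thesis using same less by auto
      next
        case False
        have "s i * (s i * (U i j - V i j) + d * (g i j - h i j)) = s i * s j * (T i j - S i j)"
          "s' i * (s' i * (U i j - V i j) + d * (g' i j - h' i j)) = s' i * s' j * (T i j - S i j)"
          using d1 d2 by simp_all
        moreover have "s i * s i = 1" "s' i * s' i = 1" using signs by auto
        ultimately have "(U i j - V i j) + d * (s i * (g i j - h i j)) = s i * s j * (T i j - S i j)"
          "(U i j - V i j) + d * (s' i * (g' i j - h' i j)) = s' i * s' j * (T i j - S i j)"
          by (simp_all add: distrib_left mult.left_commute flip: mult.assoc)
        then have k: "d * (s i * (g i j - h i j) - s' i * (g' i j - h' i j)) =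
            (s i * s j - s' i * s' j) * (T i j - S i j)"
          by (simp add: algebra_simps)
        have "s i * s j - s' i * s' j = 2 \<or> s i * s j - s' i * s' j = - 2"
          using signs False by auto
        moreover have "\<bar>2 * (T i j - S i j)\<bar> < d"
          using half[OF less(1-3) False] bT by (auto simp: d_def)
        ultimately have "\<bar>(s i * s j - s' i * s' j) * (T i j - S i j)\<bar> < d" by auto
        from bounded_multiple_zero(1)[OF k[symmetric] this] False show ?thesis by simp
      qed
      have "s i * (U i j - V i j) = d * (h i j - g i j)" "\<bar>s i * (U i j - V i j)\<bar> < d"
        using d1 TS bU signs by (auto simp: algebra_simps)
      from bounded_multiple_zero[OF this] signs have UV: "U i j = V i j" "g i j = h i j" by auto
      have "d > 0" using bU by simp
      with d2 TS UV have "g' i j = h' i j" by simp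
      with TS UV show ?case by simp
    qed
    then show "T i j = S i j" by simp
  qed
qed

end

section \<open>Lattices given by triangular bases\<close>

text \<open>
  The combination with coefficients \<open>m\<close> of the columns of the upper triangular matrix \<open>P\<close>. Vectors
  of \<open>\<rat>\<^sup>n\<close> are functions that vanish outside \<open>{1..n}\<close>.
\<close>

definition comb :: "nat \<Rightarrow> (nat \<Rightarrow> nat \<Rightarrow> rat) \<Rightarrow> (nat \<Rightarrow> int) \<Rightarrow> nat \<Rightarrow> rat" where
  "comb n P m = (\<lambda>i. if i \<in> {1..n} then \<Sum>j\<in>{i..n}. P i j * of_int (m j) else 0)"

abbreviation rat_mat :: "(nat \<Rightarrow> nat \<Rightarrow> int) \<Rightarrow> nat \<Rightarrow> nat \<Rightarrow> rat" where
  "rat_mat T \<equiv> (\<lambda>i j. of_int (T i j))"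

definition nonsingular :: "nat \<Rightarrow> (nat \<Rightarrow> nat \<Rightarrow> rat) \<Rightarrow> bool" where
  "nonsingular n P \<longleftrightarrow> (\<forall>i\<in>{1..n}. P i i \<noteq> 0)"

text \<open>
  \<open>A P = P T\<close> for the diagonal matrix \<open>A\<close> with entries \<open>a\<close>: multiplication by \<open>A\<close> has the integer
  matrix \<open>T\<close> in the basis formed by the columns of \<open>P\<close>.
\<close>

definition diagonalizes :: "nat \<Rightarrow> (nat \<Rightarrow> int) \<Rightarrow> (nat \<Rightarrow> nat \<Rightarrow> rat) \<Rightarrow> (nat \<Rightarrow> nat \<Rightarrow> int) \<Rightarrow> bool" where
  "diagonalizes n a P T \<longleftrightarrow>
     (\<forall>i j. 1 \<le> i \<longrightarrow> i \<le> j \<longrightarrow> j \<le> n \<longrightarrow> of_int (a i) * P i j = (P \<diamondop> rat_mat T) i j)"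

definition has_type :: "nat \<Rightarrow> (nat \<Rightarrow> int) \<Rightarrow> (nat \<Rightarrow> rat) set \<Rightarrow> (nat \<Rightarrow> nat \<Rightarrow> int) \<Rightarrow> bool" where
  "has_type n a L T \<longleftrightarrow>
     (\<exists>P. nonsingular n P \<and> diagonalizes n a P T \<and> L = range (comb n P))"

lemma rat_mat_mult: "rat_mat (A \<diamondop> B) i j = (rat_mat A \<diamondop> rat_mat B) i j"
  by (simp add: tri_mult_def)

text \<open>
  This is associativity of the triangular product, with the coefficient vector regarded as a matrix
  of equal columns and read off at column \<open>n\<close>.
\<close>

lemma comb_mult: "comb n (P \<diamondop> rat_mat g) m = comb n P (\<lambda>l. \<Sum>j\<in>{l..n}. g l j * m j)"
proof
  fix i
  show "comb n (P \<diamondop> rat_mat g) m i = comb n P (\<lambda>l. \<Sum>j\<in>{l..n}. g l j * m j) i"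
  proof (cases "i \<in> {1..n}")
    case True
    define M :: "nat \<Rightarrow> nat \<Rightarrow> rat" where "M = (\<lambda>j _. of_int (m j))"
    have "comb n (P \<diamondop> rat_mat g) m i = ((P \<diamondop> rat_mat g) \<diamondop> M) i n"
      using True unfolding comb_def tri_mult_def[of _ M] by (simp add: M_def)
    also have "\<dots> = (P \<diamondop> (rat_mat g \<diamondop> M)) i n" by (rule tri_mult_assoc)
    also have "\<dots> = comb n P (\<lambda>l. \<Sum>j\<in>{l..n}. g l j * m j) i"
      using True by (simp add: comb_def tri_mult_def M_def)
    finally show ?thesis .
  next
    case False
    then show ?thesis by (simp only: comb_def if_False)
  qed
qed

lemma back_substitution:
  fixes v :: "nat \<Rightarrow> int"
  assumes g: "sign_vector n (\<lambda>i. g i i)"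
  shows "\<exists>m. \<forall>i\<in>{1..n}. (\<Sum>j\<in>{i..n}. g i j * m j) = v i"
proof -
  have "\<exists>m. \<forall>i\<in>{1..n}. n < i + k \<longrightarrow> (\<Sum>j\<in>{i..n}. g i j * m j) = v i" for k
  proof (induction k)
    case 0
    then show ?case by auto
  next
    case (Suc k)
    then obtain m where m: "\<And>i. i \<in> {1..n} \<Longrightarrow> n < i + k \<Longrightarrow> (\<Sum>j\<in>{i..n}. g i j * m j) = v i"
      by blast
    define p where "p = n - k"
    define m' where "m' = m(p := g p p * (v p - (\<Sum>j\<in>{p<..n}. g p j * m j)))"
    have "(\<Sum>j\<in>{i..n}. g i j * m' j) = v i" if i: "i \<in> {1..n}" "n < i + Suc k" for i
    proof (cases "n < i + k")
      case True
      then have "m' j = m j" if "j \<in> {i..n}" for j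
        using that i(1) by (auto simp: m'_def p_def)
      then have "(\<Sum>j\<in>{i..n}. g i j * m' j) = (\<Sum>j\<in>{i..n}. g i j * m j)"
        by (intro sum.cong) auto
      then show ?thesis using m i True by simp
    next
      case False
      then have p: "i = p" "p \<in> {1..n}" using i by (auto simp: p_def)
      then have sq: "g p p * g p p = 1" using sign_vectorD[OF g, of p] by auto
      have "{p..n} = insert p {p<..n}" using p by auto
      then have "(\<Sum>j\<in>{p..n}. g p j * m' j) = g p p * m' p + (\<Sum>j\<in>{p<..n}. g p j * m' j)" by simp
      also have "(\<Sum>j\<in>{p<..n}. g p j * m' j) = (\<Sum>j\<in>{p<..n}. g p j * m j)"
        by (intro sum.cong) (auto simp: m'_def)
      also have "g p p * m' p = v p - (\<Sum>j\<in>{p<..n}. g p j * m j)"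
        using sq by (simp add: m'_def flip: mult.assoc)
      finally show ?thesis using p by simp
    qed
    then show ?case by blast
  qed
  from this[of n] show ?thesis by auto
qed

text \<open>
  A triangular integer matrix with signs on the diagonal is a change of basis of \<open>\<int>\<^sup>n\<close>.
\<close>

lemma range_comb_mult:
  assumes "sign_vector n (\<lambda>i. g i i)"
  shows "range (comb n (P \<diamondop> rat_mat g)) = range (comb n P)"
proof
  show "range (comb n (P \<diamondop> rat_mat g)) \<subseteq> range (comb n P)" by (auto simp: comb_mult)
  show "range (comb n P) \<subseteq> range (comb n (P \<diamondop> rat_mat g))"
  proof
    fix x assume "x \<in> range (comb n P)"
    then obtain v where v: "x = comb n P v" by auto
    obtain m where m: "\<forall>i\<in>{1..n}. (\<Sum>j\<in>{i..n}. g i j * m j) = v i"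
      using back_substitution[of n g v] assms by blast
    have "comb n P (\<lambda>l. \<Sum>j\<in>{l..n}. g l j * m j) = comb n P v"
      unfolding comb_def using m by (intro ext) (simp del: of_int_sum of_int_mult)
    then have "comb n (P \<diamondop> rat_mat g) m = x" unfolding comb_mult v .
    then show "x \<in> range (comb n (P \<diamondop> rat_mat g))" by auto
  qed
qed

lemma triangular_system_injective:
  fixes P :: "nat \<Rightarrow> nat \<Rightarrow> 'a::idom"
  assumes P: "\<And>i. i \<in> {k..n} \<Longrightarrow> P i i \<noteq> 0"
    and eq: "\<And>i. i \<in> {k..n} \<Longrightarrow> (\<Sum>l\<in>{i..n}. P i l * x l) = 0"
    and i: "i \<in> {k..n}"
  shows "x i = 0"
  using i
proof (induction "n - i" arbitrary: i rule: less_induct)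
  case less
  have "x l = 0" if "l \<in> {i<..n}" for l using less that by auto
  then have "(\<Sum>l\<in>{i<..n}. P i l * x l) = 0" by simp
  moreover have "{i..n} = insert i {i<..n}" using less.prems by auto
  ultimately have "(\<Sum>l\<in>{i..n}. P i l * x l) = P i i * x i" by simp
  then show ?case using eq[OF less.prems] P[OF less.prems] by simp
qed

lemma triangular_left_cancel:
  fixes P :: "nat \<Rightarrow> nat \<Rightarrow> rat"
  assumes "nonsingular n P"
    and eq: "\<And>i j. 1 \<le> i \<Longrightarrow> i \<le> j \<Longrightarrow> j \<le> n \<Longrightarrow> (P \<diamondop> B) i j = (P \<diamondop> C) i j"
    and ij: "1 \<le> i" "i \<le> j" "j \<le> n"
  shows "B i j = C i j"
proof -
  have "B i j - C i j = 0"
  proof (rule triangular_system_injective[where P = P and k = 1 and n = j and x = "\<lambda>l. B l j - C l j"])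
    show "(\<Sum>l\<in>{i..j}. P i l * (B l j - C l j)) = 0" if "i \<in> {1..j}" for i
      using eq[of i j] that ij by (simp add: tri_mult_def right_diff_distrib sum_subtractf)
  qed (use assms in \<open>auto simp: nonsingular_def\<close>)
  then show ?thesis by simp
qed

lemma diagonalizes_conj:
  assumes P: "diagonalizes n a P T" and g: "conj_via n T g T'"
  shows "diagonalizes n a (P \<diamondop> rat_mat g) T'"
  unfolding diagonalizes_def
proof (intro allI impI)
  fix i j assume ij: "1 \<le> i" "i \<le> j" "j \<le> n"
  have "of_int (a i) * (P \<diamondop> rat_mat g) i j = ((\<lambda>i j. of_int (a i) * P i j) \<diamondop> rat_mat g) i j"
    by (simp add: tri_mult_def sum_distrib_left mult.assoc)
  also have "\<dots> = ((P \<diamondop> rat_mat T) \<diamondop> rat_mat g) i j"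
    by (rule tri_mult_cong) (use P ij in \<open>auto simp: diagonalizes_def\<close>)
  also have "\<dots> = (P \<diamondop> rat_mat (T \<diamondop> g)) i j"
    by (simp add: tri_mult_assoc rat_mat_mult)
  also have "\<dots> = (P \<diamondop> rat_mat (g \<diamondop> T')) i j"
    by (rule tri_mult_cong) (use g ij in \<open>auto simp: conj_via_def\<close>)
  also have "\<dots> = ((P \<diamondop> rat_mat g) \<diamondop> rat_mat T') i j"
    by (simp add: tri_mult_assoc rat_mat_mult)
  finally show "of_int (a i) * (P \<diamondop> rat_mat g) i j = ((P \<diamondop> rat_mat g) \<diamondop> rat_mat T') i j" .
qed

lemma nonsingular_mult:
  assumes "nonsingular n P" "sign_vector n (\<lambda>i. g i i)"
  shows "nonsingular n (P \<diamondop> rat_mat g)"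
  using assms sign_vectorD[OF assms(2)] by (fastforce simp: nonsingular_def)

lemma has_type_conj:
  assumes "has_type n a L T" "conj_via n T g T'" "sign_vector n (\<lambda>i. g i i)"
  shows "has_type n a L T'"
proof -
  obtain P where P: "nonsingular n P" "diagonalizes n a P T" "L = range (comb n P)"
    using assms(1) unfolding has_type_def by blast
  show ?thesis
    unfolding has_type_def
  proof (intro exI[of _ "P \<diamondop> rat_mat g"] conjI)
    show "nonsingular n (P \<diamondop> rat_mat g)" using nonsingular_mult P(1) assms(3) .
    show "diagonalizes n a (P \<diamondop> rat_mat g) T'" by (rule diagonalizes_conj[OF P(2) assms(2)])
    show "L = range (comb n (P \<diamondop> rat_mat g))"
      using range_comb_mult[of n g P] assms(3) P(3) by simp
  qed
qed

text \<open>
  The recursive form of \<open>A P = P T\<close>: when the \<open>a\<^sub>i\<close> are distinct, it determines \<open>P\<close> from its diagonal,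
  and the diagonal is arbitrary.
\<close>

lemma diagonalizes_iff:
  assumes "has_diag n a T"
  shows "diagonalizes n a P T \<longleftrightarrow> (\<forall>i j. 1 \<le> i \<longrightarrow> i < j \<longrightarrow> j \<le> n \<longrightarrow>
    of_int (a i - a j) * P i j = (\<Sum>l\<in>{i..<j}. P i l * of_int (T l j)))" (is "_ \<longleftrightarrow> ?rhs")
proof -
  have *: "of_int (a i) * P i j = (P \<diamondop> rat_mat T) i j \<longleftrightarrow>
    of_int (a i - a j) * P i j = (\<Sum>l\<in>{i..<j}. P i l * of_int (T l j))"
    if "1 \<le> i" "i \<le> j" "j \<le> n" for i j
  proof -
    have "{i..j} = insert j {i..<j}" using that by auto
    moreover have "T j j = a j" using assms that by (auto simp: has_diag_def)
    ultimately show ?thesis by (auto simp: tri_mult_def algebra_simps)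
  qed
  have "diagonalizes n a P T \<longleftrightarrow> (\<forall>i j. 1 \<le> i \<longrightarrow> i \<le> j \<longrightarrow> j \<le> n \<longrightarrow>
    of_int (a i - a j) * P i j = (\<Sum>l\<in>{i..<j}. P i l * of_int (T l j)))"
    unfolding diagonalizes_def using * by auto
  also have "\<dots> \<longleftrightarrow> ?rhs" by (auto simp: le_less)
  finally show ?thesis .
qed

context increasing_roots
begin

lemma diagonalizer_exists:
  assumes T: "has_diag n a T"
  shows "\<exists>P. (\<forall>i. P i i = 1) \<and> diagonalizes n a P T"
proof -
  define Q where "Q P i j x \<longleftrightarrow> (if i < j then 1 \<le> i \<longrightarrow> j \<le> n \<longrightarrow>
     of_int (a i - a j) * x = (\<Sum>l\<in>{i..<j}. P i l * of_int (T l j)) else x = 1)"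
    for P :: "nat \<Rightarrow> nat \<Rightarrow> rat" and i j x
  have "\<exists>P. \<forall>i j. Q P i j (P i j)"
  proof (rule entrywise_recursion)
    show "Q f i j x = Q g i j x" if "\<And>k l. l - k < j - i \<Longrightarrow> f k l = g k l" for f g i j x
    proof -
      have "(\<Sum>l\<in>{i..<j}. f i l * of_int (T l j)) = (\<Sum>l\<in>{i..<j}. g i l * of_int (T l j))"
        by (intro sum.cong) (auto simp: that)
      then show ?thesis by (simp add: Q_def)
    qed
    show "\<exists>x. Q P i j x" for P i j
    proof (cases "1 \<le> i \<and> i < j \<and> j \<le> n")
      case True
      then have "rat_of_int (a i - a j) \<noteq> 0" using gap_pos[of i j] by simp
      then show ?thesis
        by (intro exI[of _ "(\<Sum>l\<in>{i..<j}. P i l * of_int (T l j)) / of_int (a i - a j)"])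
          (use True in \<open>simp add: Q_def\<close>)
    qed (auto simp: Q_def)
  qed
  then obtain P where P: "\<And>i j. Q P i j (P i j)" by blast
  show ?thesis
    unfolding diagonalizes_iff[OF T]
  proof (intro exI[of _ P] conjI allI impI)
    show "P i i = 1" for i using P[of i i] by (simp add: Q_def)
    show "of_int (a i - a j) * P i j = (\<Sum>l\<in>{i..<j}. P i l * of_int (T l j))"
      if "1 \<le> i" "i < j" "j \<le> n" for i j
      using P[of i j] that by (simp add: Q_def)
  qed
qed

lemma diagonalizer_unique:
  assumes T: "has_diag n a T" and P: "diagonalizes n a P T" and Q: "diagonalizes n a Q T"
    and d: "\<And>i. i \<in> {1..n} \<Longrightarrow> P i i = Q i i" and ij: "1 \<le> i" "i \<le> j" "j \<le> n"
  shows "P i j = Q i j"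
proof (cases "i = j")
  case False
  then have "1 \<le> i" "i < j" "j \<le> n" using ij by auto
  then show ?thesis
  proof (induction rule: entrywise_induct)
    case (less i j)
    have "P i l = Q i l" if "l \<in> {i..<j}" for l
      using less.IH[of i l] less(1-3) that d[of i] by (cases "i = l") auto
    then have "(\<Sum>l\<in>{i..<j}. P i l * of_int (T l j)) = (\<Sum>l\<in>{i..<j}. Q i l * of_int (T l j))"
      by simp
    then have "rat_of_int (a i - a j) * P i j = of_int (a i - a j) * Q i j"
      using P Q less(1-3) unfolding diagonalizes_iff[OF T] by metis
    then show ?case using gap_pos[OF less(1-3)] by simp
  qed
qed (use d ij in auto)

lemma type_has_lattice:
  assumes "has_diag n a T"
  shows "\<exists>L. has_type n a L T"
  using diagonalizer_exists[OF assms] unfolding has_type_def nonsingular_def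
  by (metis one_neq_zero)

end

text \<open>
  An inclusion of lattices expresses the columns of \<open>Q\<close> by those of \<open>P\<close>. The coefficient matrix is
  upper triangular because \<open>P\<close> and \<open>Q\<close> are.
\<close>

lemma columns_in_span:
  assumes P: "nonsingular n P" and Q: "range (comb n Q) \<subseteq> range (comb n P)"
  shows "\<exists>g. \<forall>i j. 1 \<le> i \<longrightarrow> i \<le> j \<longrightarrow> j \<le> n \<longrightarrow> Q i j = (P \<diamondop> rat_mat g) i j"
proof -
  have "\<exists>m. \<forall>i. 1 \<le> i \<longrightarrow> i \<le> j \<longrightarrow> Q i j = (\<Sum>l\<in>{i..j}. P i l * of_int (m l))"
    if j: "j \<in> {1..n}" for j
  proof -
    have "comb n Q (\<lambda>l. if l = j then 1 else 0) \<in> range (comb n P)" using Q by auto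
    then obtain m where m: "comb n Q (\<lambda>l. if l = j then 1 else 0) = comb n P m" by auto
    have eq: "(\<Sum>l\<in>{i..n}. P i l * of_int (m l)) = (if i \<le> j then Q i j else 0)" if "i \<in> {1..n}" for i
    proof -
      have "(if i \<le> j then Q i j else 0) = (\<Sum>l\<in>{i..n}. Q i l * of_int (if l = j then 1 else 0))"
        using j by (simp add: if_distrib[of of_int] if_distrib[of "\<lambda>x. _ * x"] sum.delta cong: if_cong)
      also have "\<dots> = comb n P m i" using that unfolding m[symmetric] by (simp add: comb_def)
      finally show ?thesis using that by (simp add: comb_def)
    qed
    have zero: "m l = 0" if "l \<in> {Suc j..n}" for l
    proof -
      have "(of_int (m l) :: rat) = 0"
        by (rule triangular_system_injective[where P = P and k = "Suc j" and n = n])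
          (use that P eq in \<open>auto simp: nonsingular_def\<close>)
      then show ?thesis by simp
    qed
    have "Q i j = (\<Sum>l\<in>{i..j}. P i l * of_int (m l))" if "1 \<le> i" "i \<le> j" for i
    proof -
      have "(\<Sum>l\<in>{i..j}. P i l * of_int (m l)) = (\<Sum>l\<in>{i..n}. P i l * of_int (m l))"
        by (rule sum.mono_neutral_left) (use j zero in auto)
      then show ?thesis using eq[of i] that j by simp
    qed
    then show ?thesis by blast
  qed
  then obtain m where "\<And>i j. j \<in> {1..n} \<Longrightarrow> 1 \<le> i \<Longrightarrow> i \<le> j \<Longrightarrow>
      Q i j = (\<Sum>l\<in>{i..j}. P i l * of_int (m j l))" by metis
  then show ?thesis
    by (intro exI[of _ "\<lambda>i j. m j i"]) (auto simp: tri_mult_def)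
qed

text \<open>
  The two bases differ by integer triangular matrices \<open>g\<close> and \<open>h\<close> in either direction, so
  \<open>g\<^sub>i\<^sub>i h\<^sub>i\<^sub>i = 1\<close>. Then \<open>P (T g) = A P g = A Q = Q T' = P (g T')\<close>, and \<open>P\<close> cancels.
\<close>

lemma same_lattice_conj:
  assumes P: "nonsingular n P" "diagonalizes n a P T"
    and Q: "nonsingular n Q" "diagonalizes n a Q T'"
    and eq: "range (comb n Q) = range (comb n P)"
  shows "\<exists>g. sign_vector n (\<lambda>i. g i i) \<and> conj_via n T g T'"
proof -
  obtain g where g: "\<And>i j. 1 \<le> i \<Longrightarrow> i \<le> j \<Longrightarrow> j \<le> n \<Longrightarrow> Q i j = (P \<diamondop> rat_mat g) i j"
    using columns_in_span[of n P Q] P(1) eq by blast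
  obtain h where h: "\<And>i j. 1 \<le> i \<Longrightarrow> i \<le> j \<Longrightarrow> j \<le> n \<Longrightarrow> P i j = (Q \<diamondop> rat_mat h) i j"
    using columns_in_span[of n Q P] Q(1) eq by blast
  have "g i i = 1 \<or> g i i = - 1" if "i \<in> {1..n}" for i
  proof -
    have ii: "1 \<le> i" "i \<le> i" "i \<le> n" using that by auto
    have "P i i = P i i * of_int (g i i * h i i)"
      using h[OF ii] unfolding g[OF ii, simplified tri_mult_diag] tri_mult_diag
      by (simp only: of_int_mult mult.assoc)
    moreover have "P i i \<noteq> 0" using P(1) that by (simp add: nonsingular_def)
    ultimately have "rat_of_int (g i i * h i i) = 1" by (metis mult_cancel_left mult.right_neutral)
    then have "g i i * h i i = 1" by (simp only: of_int_eq_1_iff)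
    then show ?thesis using zmult_eq_1_iff by blast
  qed
  moreover have "conj_via n T g T'"
    unfolding conj_via_def
  proof (intro allI impI)
    fix i j assume ij: "1 \<le> i" "i \<le> j" "j \<le> n"
    have "rat_mat (T \<diamondop> g) i j = rat_mat (g \<diamondop> T') i j"
    proof (rule triangular_left_cancel[OF P(1) _ ij])
      fix i j assume ij: "1 \<le> i" "i \<le> j" "j \<le> n"
      have "(P \<diamondop> rat_mat (T \<diamondop> g)) i j = ((P \<diamondop> rat_mat T) \<diamondop> rat_mat g) i j"
        by (simp add: tri_mult_assoc rat_mat_mult)
      also have "\<dots> = ((\<lambda>i j. of_int (a i) * P i j) \<diamondop> rat_mat g) i j"
        by (rule tri_mult_cong) (use P ij in \<open>auto simp: diagonalizes_def\<close>)
      also have "\<dots> = of_int (a i) * (P \<diamondop> rat_mat g) i j"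
        by (simp add: tri_mult_def sum_distrib_left mult.assoc)
      also have "\<dots> = (Q \<diamondop> rat_mat T') i j"
        unfolding g[OF ij, symmetric] by (rule Q(2)[unfolded diagonalizes_def, rule_format, OF ij])
      also have "\<dots> = ((P \<diamondop> rat_mat g) \<diamondop> rat_mat T') i j"
        by (rule tri_mult_cong) (use g ij in auto)
      also have "\<dots> = (P \<diamondop> rat_mat (g \<diamondop> T')) i j"
        by (simp add: tri_mult_assoc rat_mat_mult)
      finally show "(P \<diamondop> rat_mat (T \<diamondop> g)) i j = (P \<diamondop> rat_mat (g \<diamondop> T')) i j" .
    qed
    then show "(T \<diamondop> g) i j = (g \<diamondop> T') i j" by simp
  qed
  ultimately show ?thesis unfolding sign_vector_def by blast
qed

definition scale :: "(nat \<Rightarrow> rat) \<Rightarrow> (nat \<Rightarrow> rat) set \<Rightarrow> (nat \<Rightarrow> rat) set" where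
  "scale d L = (\<lambda>v i. d i * v i) ` L"

lemma scale_range_comb: "scale d (range (comb n P)) = range (comb n (\<lambda>i j. d i * P i j))"
proof -
  have "(\<lambda>i. d i * comb n P m i) = comb n (\<lambda>i j. d i * P i j) m" for m
    by (auto simp: comb_def sum_distrib_left mult.assoc)
  then show ?thesis by (auto simp: scale_def image_image)
qed

lemma diagonalizes_scale:
  assumes "diagonalizes n a P T"
  shows "diagonalizes n a (\<lambda>i j. d i * P i j) T"
proof -
  have "((\<lambda>i j. d i * P i j) \<diamondop> rat_mat T) i j = d i * (P \<diamondop> rat_mat T) i j" for i j
    by (simp add: tri_mult_def sum_distrib_left mult.assoc)
  then show ?thesis using assms by (simp add: diagonalizes_def mult.left_commute)
qed

lemma comb_cong:
  assumes "\<And>i j. 1 \<le> i \<Longrightarrow> i \<le> j \<Longrightarrow> j \<le> n \<Longrightarrow> P i j = Q i j"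
  shows "comb n P = comb n Q"
  by (intro ext) (auto simp: comb_def assms intro!: sum.cong)

text \<open>
  If \<open>L = d L'\<close>, then scaling a triangular basis of \<open>L'\<close> by \<open>d\<close> gives a second one of \<open>L\<close>, still of
  type \<open>T'\<close>. Conversely, after a change of basis \<open>L\<close> also has type \<open>T'\<close>; its basis matrix and that
  of \<open>L'\<close> solve the same equation \<open>A P = P T'\<close>, and the solutions of that equation are determined by
  their diagonals, so they differ by a diagonal factor.
\<close>

lemma (in increasing_roots) scale_equivalent_iff_conj:
  assumes L: "has_type n a L T" and L': "has_type n a L' T'"
    and T': "has_diag n a T'"
  shows "(\<exists>d. (\<forall>i\<in>{1..n}. d i \<noteq> 0) \<and> L = scale d L') \<longleftrightarrow>
    (\<exists>g. sign_vector n (\<lambda>i. g i i) \<and> conj_via n T g T')"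
proof
  assume "\<exists>d. (\<forall>i\<in>{1..n}. d i \<noteq> 0) \<and> L = scale d L'"
  then obtain d where d: "\<And>i. i \<in> {1..n} \<Longrightarrow> d i \<noteq> 0" "L = scale d L'" by blast
  obtain P where P: "nonsingular n P" "diagonalizes n a P T" "L = range (comb n P)"
    using L unfolding has_type_def by blast
  obtain Q where Q: "nonsingular n Q" "diagonalizes n a Q T'" "L' = range (comb n Q)"
    using L' unfolding has_type_def by blast
  show "\<exists>g. sign_vector n (\<lambda>i. g i i) \<and> conj_via n T g T'"
    by (rule same_lattice_conj[OF P(1,2) _ diagonalizes_scale[OF Q(2), of d]])
      (use Q(1,3) P(3) d in \<open>auto simp: nonsingular_def scale_range_comb\<close>)
next
  assume "\<exists>g. sign_vector n (\<lambda>i. g i i) \<and> conj_via n T g T'"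
  then have "has_type n a L T'" using has_type_conj[OF L] by blast
  then obtain P where P: "nonsingular n P" "diagonalizes n a P T'" "L = range (comb n P)"
    unfolding has_type_def by blast
  obtain Q where Q: "nonsingular n Q" "diagonalizes n a Q T'" "L' = range (comb n Q)"
    using L' unfolding has_type_def by blast
  define d where "d i = P i i / Q i i" for i
  have "P i j = d i * Q i j" if "1 \<le> i" "i \<le> j" "j \<le> n" for i j
    by (rule diagonalizer_unique[OF T' P(2) diagonalizes_scale[OF Q(2), of d]])
      (use Q(1) that in \<open>auto simp: d_def nonsingular_def\<close>)
  then have "comb n P = comb n (\<lambda>i j. d i * Q i j)" by (rule comb_cong)
  then have "L = scale d L'" by (simp add: P(3) Q(3) scale_range_comb)
  moreover have "\<forall>i\<in>{1..n}. d i \<noteq> 0" using P(1) Q(1) by (auto simp: d_def nonsingular_def)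
  ultimately show "\<exists>d. (\<forall>i\<in>{1..n}. d i \<noteq> 0) \<and> L = scale d L'" by blast
qed

section \<open>Triangular bases of arbitrary lattices\<close>

definition int_comb :: "nat \<Rightarrow> (nat \<Rightarrow> nat \<Rightarrow> rat) \<Rightarrow> (nat \<Rightarrow> int) \<Rightarrow> nat \<Rightarrow> rat" where
  "int_comb n B m = (\<lambda>i. \<Sum>k<n. of_int (m k) * B k i)"

lemma int_comb_add: "int_comb n B m i + of_int c * int_comb n B m' i = int_comb n B (\<lambda>k. m k + c * m' k) i"
  by (simp add: int_comb_def sum_distrib_left distrib_right sum.distrib mult.assoc)

lemma common_denominator:
  fixes S :: "rat set"
  assumes "finite S"
  shows "\<exists>D::int. D > 0 \<and> (\<forall>x\<in>S. of_int D * x \<in> \<int>)"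
  using assms
proof (induction S rule: finite_induct)
  case empty
  then show ?case by (intro exI[of _ 1]) auto
next
  case (insert x S)
  then obtain D where D: "D > 0" "\<forall>x\<in>S. rat_of_int D * x \<in> \<int>" by blast
  obtain p q where x: "x = Rat.Fract p q" "q > 0" by (cases x) auto
  have "rat_of_int (q * D) * x = of_int (D * p)" using x by (simp add: Rat.Fract_of_int_quotient)
  then have "rat_of_int (q * D) * x \<in> \<int>" by (metis Ints_of_int)
  moreover have "rat_of_int (q * D) * y \<in> \<int>" if "y \<in> S" for y
  proof -
    have "of_int q * (rat_of_int D * y) \<in> \<int>"
      by (rule Ints_mult[OF Ints_of_int]) (use D(2) that in blast)
    then show ?thesis by (simp add: mult.assoc)
  qed
  ultimately show ?case using D(1) x(2)
    by (intro exI[of _ "q * D"] conjI ballI) (auto simp del: of_int_mult)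
qed

text \<open>
  For each \<open>k\<close>, the \<open>k\<close>-th coordinates of the lattice vectors that vanish beyond \<open>k\<close> form a subgroup
  of \<open>\<rat>\<close> with bounded denominators. Such a subgroup is cyclic, and lifts of the generators form the
  triangular basis. If one of the generators were \<open>0\<close>, then \<open>n - 1\<close> vectors would generate the lattice
  \<open>L\<close>, so \<open>L / 2L\<close> would have at most \<open>2\<^bsup>n-1\<^esup>\<close> elements; but it has \<open>2\<^sup>n\<close>, since the given generators are
  independent.
\<close>

lemma triangular_basis:
  fixes B :: "nat \<Rightarrow> nat \<Rightarrow> rat"
  assumes supp: "\<And>k i. k < n \<Longrightarrow> i \<notin> {1..n} \<Longrightarrow> B k i = 0"
    and indep: "\<And>m k. int_comb n B m = (\<lambda>_. 0) \<Longrightarrow> k < n \<Longrightarrow> m k = 0"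
  shows "\<exists>P. nonsingular n P \<and> range (int_comb n B) = range (comb n P)"
proof -
  define L where "L = range (int_comb n B)"
  have lin: "(\<lambda>i. u i + of_int c * v i) \<in> L" if uv: "u \<in> L" "v \<in> L" for u v c
  proof -
    obtain m m' where "u = int_comb n B m" "v = int_comb n B m'" using uv by (auto simp: L_def)
    then have "(\<lambda>i. u i + of_int c * v i) = int_comb n B (\<lambda>k. m k + c * m' k)"
      by (auto simp: int_comb_add)
    then show ?thesis by (auto simp: L_def)
  qed
  have zero: "(\<lambda>_. 0) \<in> L"
    unfolding L_def by (rule range_eqI[of _ _ "\<lambda>_. 0"]) (simp add: int_comb_def)
  have suppL: "v i = 0" if "v \<in> L" "i \<notin> {1..n}" for v i
    using that supp by (auto simp: L_def int_comb_def)
  obtain D :: int where D: "D > 0" "\<And>k i. k < n \<Longrightarrow> i \<in> {1..n} \<Longrightarrow> of_int D * B k i \<in> \<int>"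
    using common_denominator[of "(\<lambda>(k, i). B k i) ` ({..<n} \<times> {1..n})"] by auto
  have DL: "of_int D * v i \<in> \<int>" if v: "v \<in> L" for v i
  proof -
    obtain m where m: "v = int_comb n B m" using v by (auto simp: L_def)
    have "of_int D * B k i \<in> \<int>" if "k < n" for k
      using D(2)[OF that, of i] supp[OF that, of i] by (cases "i \<in> {1..n}") auto
    from Ints_mult[OF Ints_of_int this]
    have "of_int (m k) * (of_int D * B k i) \<in> \<int>" if "k < n" for k
      using that .
    moreover have "of_int D * v i = (\<Sum>k<n. of_int (m k) * (of_int D * B k i))"
      by (simp add: m int_comb_def sum_distrib_left mult.left_commute)
    ultimately show ?thesis by (auto intro!: Ints_sum)
  qed
  have "\<exists>b\<in>L. (\<forall>i>k. b i = 0) \<and> (b k = 0 \<longrightarrow> b = (\<lambda>_. 0)) \<and>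
      (\<forall>v\<in>L. (\<forall>i>k. v i = 0) \<longrightarrow> (\<exists>z::int. v k = of_int z * b k))" for k
  proof (cases "\<exists>v\<in>L. (\<forall>i>k. v i = 0) \<and> v k \<noteq> 0")
    case False
    then show ?thesis using zero by (intro bexI[of _ "\<lambda>_. 0"]) auto
  next
    case True
    \<comment> \<open>A vector whose \<open>k\<close>-th coordinate has least positive absolute value generates; the common
      denominator \<open>D\<close> turns these absolute values into natural numbers.\<close>
    define size where "size v = nat \<lfloor>\<bar>of_int D * v k\<bar>\<rfloor>" for v :: "nat \<Rightarrow> rat"
    have size: "of_nat (size v) = of_int D * \<bar>v k\<bar>" if v: "v \<in> L" for v
    proof -
      have "\<bar>of_int D * v k\<bar> \<in> \<int>" using DL[OF v] by (rule Ints_abs)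
      then have "rat_of_int \<lfloor>\<bar>of_int D * v k\<bar>\<rfloor> = \<bar>of_int D * v k\<bar>" by (simp add: of_int_floor)
      then show ?thesis using D(1) by (simp add: size_def abs_mult)
    qed
    define b where "b = arg_min size (\<lambda>v. v \<in> L \<and> (\<forall>i>k. v i = 0) \<and> v k \<noteq> 0)"
    have b: "b \<in> L" "\<forall>i>k. b i = 0" "b k \<noteq> 0"
      and bmin: "size b \<le> size v" if "v \<in> L" "\<forall>i>k. v i = 0" "v k \<noteq> 0" for v
      using True arg_min_nat_lemma[of "\<lambda>v. v \<in> L \<and> (\<forall>i>k. v i = 0) \<and> v k \<noteq> 0" _ size] that
      unfolding b_def by blast+
    have b: "b \<in> L" "\<forall>i>k. b i = 0" "b k \<noteq> 0" using True b by blast+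
    have "\<exists>z::int. v k = of_int z * b k" if v: "v \<in> L" "\<forall>i>k. v i = 0" for v
    proof -
      define z where "z = \<lfloor>v k / b k\<rfloor>"
      define w where "w = (\<lambda>i. v i + of_int (- z) * b i)"
      have w: "w \<in> L" "\<forall>i>k. w i = 0" using lin[OF v(1) b(1), of "- z"] v b by (auto simp: w_def)
      have "w k = (v k / b k - of_int z) * b k" using b(3) by (simp add: w_def algebra_simps)
      moreover have "0 \<le> v k / b k - of_int z" "v k / b k - of_int z < 1"
        unfolding z_def by linarith+
      ultimately have "\<bar>w k\<bar> < \<bar>b k\<bar>" using b(3) by (simp add: abs_mult)
      then have "rat_of_nat (size w) < of_nat (size b)"
        unfolding size[OF w(1)] size[OF b(1)] using D(1) by simp
      then have "w k = 0" using bmin[OF w] by force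
      then show ?thesis by (intro exI[of _ z]) (simp add: w_def)
    qed
    then show ?thesis using b by blast
  qed
  then obtain b where b: "\<And>k. b k \<in> L" "\<And>k i. k < i \<Longrightarrow> b k i = 0"
    "\<And>k. b k k = 0 \<Longrightarrow> b k = (\<lambda>_. 0)"
    "\<And>k v. v \<in> L \<Longrightarrow> (\<forall>i>k. v i = 0) \<Longrightarrow> \<exists>z::int. v k = of_int z * b k k"
    by metis
  define P where "P = (\<lambda>i j. b j i)"
  have comb_P: "comb n P m = (\<lambda>i. \<Sum>l\<in>{1..n}. of_int (m l) * b l i)" for m
  proof
    fix i
    show "comb n P m i = (\<Sum>l\<in>{1..n}. of_int (m l) * b l i)"
    proof (cases "i \<in> {1..n}")
      case True
      then have "comb n P m i = (\<Sum>l\<in>{i..n}. of_int (m l) * b l i)"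
        by (simp add: comb_def P_def mult.commute)
      also have "\<dots> = (\<Sum>l\<in>{1..n}. of_int (m l) * b l i)"
        by (rule sum.mono_neutral_left) (use True b(2) in auto)
      finally show ?thesis .
    next
      case False
      then have "b l i = 0" for l using suppL[OF b(1)] by blast
      with False show ?thesis by (simp only: comb_def if_False) simp
    qed
  qed
  have sub: "comb n P m \<in> L" for m
  proof -
    have "(\<lambda>i. \<Sum>l\<in>{1..j}. of_int (m l) * b l i) \<in> L" for j
    proof (induction j)
      case 0
      then show ?case using zero by simp
    next
      case (Suc j)
      then show ?case using lin[OF Suc b(1), of "m (Suc j)" "Suc j"] by simp
    qed
    then show ?thesis unfolding comb_P .
  qed
  have span: "\<exists>m. \<forall>i. v i = (\<Sum>l\<in>{1..j}. of_int (m l) * b l i)"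
    if "v \<in> L" "\<forall>i>j. v i = 0" for v j
    using that
  proof (induction j arbitrary: v)
    case 0
    have "v i = 0" for i using suppL[OF 0(1), of i] 0(2) by (cases i) auto
    then show ?case by simp
  next
    case (Suc j)
    obtain z :: int where z: "v (Suc j) = of_int z * b (Suc j) (Suc j)" using b(4)[OF Suc.prems] by blast
    define w where "w = (\<lambda>i. v i + of_int (- z) * b (Suc j) i)"
    have "w \<in> L" unfolding w_def by (rule lin[OF Suc.prems(1) b(1)])
    moreover have "\<forall>i>j. w i = 0"
    proof (intro allI impI)
      fix i assume "i > j"
      then consider "i = Suc j" | "i > Suc j" by linarith
      then show "w i = 0" using z Suc.prems(2) b(2) by cases (auto simp: w_def)
    qed
    ultimately obtain m where m: "\<And>i. w i = (\<Sum>l\<in>{1..j}. of_int (m l) * b l i)"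
      using Suc.IH by blast
    have "v i = (\<Sum>l\<in>{1..Suc j}. of_int ((m(Suc j := z)) l) * b l i)" for i
    proof -
      have "v i = w i + of_int z * b (Suc j) i" by (simp add: w_def)
      also have "w i = (\<Sum>l\<in>{1..j}. of_int ((m(Suc j := z)) l) * b l i)"
        unfolding m by (intro sum.cong) auto
      finally show ?thesis by simp
    qed
    then show ?case by blast
  qed
  have eq: "L = range (comb n P)"
  proof
    show "L \<subseteq> range (comb n P)"
    proof
      fix v assume v: "v \<in> L"
      obtain m where "\<And>i. v i = (\<Sum>l\<in>{1..n}. of_int (m l) * b l i)"
        using span[OF v, of n] suppL[OF v] by auto
      then have "v = comb n P m" unfolding comb_P by blast
      then show "v \<in> range (comb n P)" by blast
    qed
  qed (use sub in auto)
  have "b k k \<noteq> 0" if k: "k \<in> {1..n}" for k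
  proof
    assume "b k k = 0"
    then have bk: "b k i = 0" for i using b(3)[of k] by simp
    \<comment> \<open>\<open>u e\<close> runs through representatives of all \<open>2\<^sup>n\<close> classes of \<open>L\<close> modulo \<open>2L\<close>.\<close>
    define u where "u e = int_comb n B (\<lambda>l. if l \<in> e then 1 else 0)" for e
    have "\<exists>m. u e = comb n P m" for e
      using eq unfolding L_def u_def by auto
    then obtain m where m: "\<And>e. u e = comb n P (m e)" by metis
    define odds where "odds e = {l \<in> {1..n} - {k}. odd (m e l)}" for e
    have "odds ` Pow {..<n} \<subseteq> Pow ({1..n} - {k})" by (auto simp: odds_def)
    moreover have "card (Pow ({1..n} - {k})) < card (Pow {..<n})"
      using k by (simp add: card_Pow card_Diff_singleton)
    ultimately have "\<not> inj_on odds (Pow {..<n})"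
      by (meson card_inj_on_le finite_Diff finite_Pow_iff finite_atLeastAtMost not_le)
    then obtain e e' where e: "e \<subseteq> {..<n}" "e' \<subseteq> {..<n}" "e \<noteq> e'" "odds e = odds e'"
      by (auto simp: inj_on_def)
    define h where "h l = (m e l - m e' l) div 2" for l
    have h: "m e l - m e' l = 2 * h l" if "l \<in> {1..n} - {k}" for l
    proof -
      have "odd (m e l) \<longleftrightarrow> odd (m e' l)" using e(4) that unfolding odds_def by blast
      then show ?thesis unfolding h_def by simp
    qed
    have "comb n P h \<in> L" by (rule sub)
    then obtain c where c: "comb n P h = int_comb n B c" unfolding L_def by auto
    have "u e i - u e' i = 2 * comb n P h i" for i
    proof -
      have "u e i - u e' i = (\<Sum>l\<in>{1..n}. of_int (m e l - m e' l) * b l i)"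
        unfolding m comb_P by (simp add: sum_subtractf left_diff_distrib)
      also have "\<dots> = (\<Sum>l\<in>{1..n}. 2 * (of_int (h l) * b l i))"
      proof (rule sum.cong)
        fix l assume "l \<in> {1..n}"
        then show "of_int (m e l - m e' l) * b l i = 2 * (of_int (h l) * b l i)"
          using h[of l] bk[of i] by (cases "l = k") auto
      qed simp
      finally show ?thesis unfolding comb_P by (simp add: sum_distrib_left)
    qed
    then have "int_comb n B (\<lambda>l. (if l \<in> e then 1 else 0) - (if l \<in> e' then 1 else 0) - 2 * c l) i = 0" for i
      unfolding c u_def int_comb_def
      by (simp add: sum_distrib_left left_diff_distrib sum_subtractf mult.assoc)
    then have "(if l \<in> e then 1 else 0) - (if l \<in> e' then 1 else 0) - 2 * c l = 0" if "l < n" for l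
      using that by (intro indep[where m = "\<lambda>l. (if l \<in> e then 1 else 0) - (if l \<in> e' then 1 else 0) - 2 * c l"]) auto
    then have "l \<in> e \<longleftrightarrow> l \<in> e'" if "l < n" for l
      using that by (fastforce split: if_splits dest: arg_cong[of _ _ even])
    then show False using e by blast
  qed
  then have "nonsingular n P" by (simp add: nonsingular_def P_def)
  then show ?thesis using eq unfolding L_def by blast
qed

text \<open>
  Stability under \<open>A\<close> expresses \<open>A P\<close> by the columns of \<open>P\<close>, which yields some type; its normal form
  is then also a type of the lattice.
\<close>

lemma (in increasing_roots) stable_lattice_has_type:
  assumes P: "nonsingular n P"
    and stable: "\<And>v. v \<in> range (comb n P) \<Longrightarrow> (\<lambda>i. of_int (a i) * v i) \<in> range (comb n P)"
  shows "\<exists>T\<in>reduced n a. has_type n a (range (comb n P)) T"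
proof -
  have "range (comb n (\<lambda>i j. of_int (a i) * P i j)) \<subseteq> range (comb n P)"
    using stable by (auto simp flip: scale_range_comb simp: scale_def)
  then obtain T where T: "\<And>i j. 1 \<le> i \<Longrightarrow> i \<le> j \<Longrightarrow> j \<le> n \<Longrightarrow> of_int (a i) * P i j = (P \<diamondop> rat_mat T) i j"
    using columns_in_span[OF P] by blast
  then have "diagonalizes n a P T" by (simp add: diagonalizes_def)
  then have L: "has_type n a (range (comb n P)) T" using P unfolding has_type_def by blast
  have "has_diag n a T"
    unfolding has_diag_def
  proof
    fix i assume i: "i \<in> {1..n}"
    then have "rat_of_int (a i) * P i i = of_int (T i i) * P i i" using T[of i i] by simp
    then show "T i i = a i" using P i by (simp add: nonsingular_def)
  qed
  then obtain g T' where g: "T' \<in> reduced n a" "\<forall>i\<in>{1..n}. g i i = 1" "conj_via n T g T'"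
    using normal_form_exists[of T "\<lambda>_. 1"] by (auto simp: sign_vector_def)
  then have "has_type n a (range (comb n P)) T'"
    using has_type_conj[OF L g(3)] by (auto simp: sign_vector_def)
  then show ?thesis using g by blast
qed

lemma has_type_stable:
  assumes "has_type n a L T" "v \<in> L"
  shows "(\<lambda>i. of_int (a i) * v i) \<in> L"
proof -
  obtain P m where P: "nonsingular n P" "diagonalizes n a P T" "L = range (comb n P)" "v = comb n P m"
    using assms unfolding has_type_def by blast
  have "(\<lambda>i. of_int (a i) * v i) = comb n (\<lambda>i j. of_int (a i) * P i j) m"
    unfolding P(4) by (auto simp: comb_def sum_distrib_left mult.assoc)
  also have "\<dots> = comb n (P \<diamondop> rat_mat T) m"
    using P(2) by (subst comb_cong[of n _ "P \<diamondop> rat_mat T"]) (auto simp: diagonalizes_def)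
  also have "\<dots> = comb n P (\<lambda>l. \<Sum>j\<in>{l..n}. T l j * m j)"
    by (rule comb_mult)
  finally show ?thesis using P by auto
qed

section \<open>Evaluation at the roots\<close>

lemma map_poly_of_int_mult: "map_poly of_int (p * q :: int poly) = map_poly of_int p * map_poly of_int q"
  by (rule poly_eqI) (simp add: coeff_map_poly coeff_mult)

lemma poly_map_poly_of_int: "poly (map_poly of_int p) (of_int x) = of_int (poly p x)"
  by (induction p) (auto simp: map_poly_pCons)

lemma prod_linear_dvd_iff:
  fixes c :: "'i \<Rightarrow> 'a::field"
  assumes "finite A" "inj_on c A"
  shows "(\<Prod>i\<in>A. [:- c i, 1:]) dvd p \<longleftrightarrow> (\<forall>i\<in>A. poly p (c i) = 0)"
  using assms
proof (induction A arbitrary: p rule: finite_induct)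
  case (insert x A)
  show ?case
  proof
    assume "(\<Prod>i\<in>insert x A. [:- c i, 1:]) dvd p"
    then have "[:- c i, 1:] dvd p" if "i \<in> insert x A" for i
      using that insert.hyps by (meson dvd_prodI dvd_trans finite.insertI)
    then show "\<forall>i\<in>insert x A. poly p (c i) = 0" by (simp add: poly_eq_0_iff_dvd)
  next
    assume roots: "\<forall>i\<in>insert x A. poly p (c i) = 0"
    then obtain q where q: "p = (\<Prod>i\<in>A. [:- c i, 1:]) * q"
      using insert by (metis dvdE inj_on_insert insertCI)
    have "(\<Prod>i\<in>A. c x - c i) * poly q (c x) = 0"
      using roots by (simp add: q poly_prod)
    moreover have "(\<Prod>i\<in>A. c x - c i) \<noteq> 0"
      using insert by (auto simp: inj_on_def)
    ultimately have "[:- c x, 1:] dvd q" by (simp add: poly_eq_0_iff_dvd)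
    then show "(\<Prod>i\<in>insert x A. [:- c i, 1:]) dvd p"
      using insert.hyps by (metis q mult.commute mult_dvd_mono dvd_refl prod.insert)
  qed
qed simp

lemma interpolation:
  fixes c v :: "'i \<Rightarrow> 'a::field"
  assumes "finite A" "inj_on c A"
  shows "\<exists>p. \<forall>i\<in>A. poly p (c i) = v i"
  using assms
proof (induction A rule: finite_induct)
  case (insert x A)
  then obtain p where p: "\<forall>i\<in>A. poly p (c i) = v i" by auto
  define w where "w = (\<Prod>i\<in>A. [:- c i, 1:])"
  have w0: "poly w (c i) = 0" if "i \<in> A" for i
    using that insert.hyps by (auto simp: w_def poly_prod)
  have wx: "poly w (c x) \<noteq> 0" using insert by (auto simp: w_def poly_prod inj_on_def)
  show ?case
    by (intro exI[of _ "p + smult ((v x - poly p (c x)) / poly w (c x)) w"]) (use p w0 wx in auto)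
qed simp

context increasing_roots
begin

abbreviation "K \<equiv> QX_mod (chi n a)"

definition residue :: "rat poly \<Rightarrow> rat poly set" where
  "residue p = QX_ideal (chi n a) +>\<^bsub>ring_of_type_algebra\<^esub> p"

definition root_values :: "rat poly \<Rightarrow> nat \<Rightarrow> rat" where
  "root_values p = (\<lambda>i. if i \<in> {1..n} then poly p (of_int (a i)) else 0)"

text \<open>
  All representatives of a residue class have the same values at the roots, so the choice is
  immaterial.
\<close>

definition coords :: "rat poly set \<Rightarrow> nat \<Rightarrow> rat" where
  "coords A = root_values (SOME p. p \<in> A)"

lemma inj_roots: "inj_on (\<lambda>i. rat_of_int (a i)) {1..n}"
  using strict_mono_on_imp_inj_on[OF increasing] unfolding inj_on_def by (simp only: of_int_eq_iff)

lemma map_poly_chi: "map_poly rat_of_int (chi n a) = (\<Prod>i\<in>{1..n}. [:- of_int (a i), 1:])"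
proof -
  have "map_poly rat_of_int (\<Prod>i\<in>A. [:- a i, 1:]) = (\<Prod>i\<in>A. [:- of_int (a i), 1:])"
    if "finite A" for A
    using that by (induction A rule: finite_induct)
      (simp_all add: map_poly_of_int_mult map_poly_pCons del: mult_pCons_left)
  then show ?thesis by (simp add: chi_def)
qed

lemma degree_chi: "Polynomial.degree (chi n a) = n"
  unfolding chi_def by (subst degree_prod_eq_sum_degree) auto

lemma QX_ideal_iff: "p \<in> QX_ideal (chi n a) \<longleftrightarrow> (\<forall>i\<in>{1..n}. poly p (of_int (a i)) = 0)"
proof -
  have "p \<in> QX_ideal (chi n a) \<longleftrightarrow> map_poly of_int (chi n a) dvd p"
    by (auto simp: QX_ideal_def cgenideal_def ring_of_type_algebra_def dvd_def mult.commute)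
  then show ?thesis unfolding map_poly_chi using prod_linear_dvd_iff[OF _ inj_roots] by simp
qed

lemma mem_residue_iff: "q \<in> residue p \<longleftrightarrow> root_values q = root_values p"
proof -
  have "q \<in> residue p \<longleftrightarrow> q - p \<in> QX_ideal (chi n a)"
    by (auto simp: residue_def a_r_coset_def r_coset_def ring_of_type_algebra_def
        intro: bexI[of _ "q - p"])
  also have "\<dots> \<longleftrightarrow> root_values q = root_values p"
    by (auto simp: QX_ideal_iff root_values_def fun_eq_iff)
  finally show ?thesis .
qed

lemma residue_eq_iff: "residue p = residue q \<longleftrightarrow> root_values p = root_values q"
proof
  assume "residue p = residue q"
  then have "p \<in> residue q" using mem_residue_iff[of p p] by simp
  then show "root_values p = root_values q" by (simp only: mem_residue_iff)
next
  assume "root_values p = root_values q"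
  then show "residue p = residue q" by (auto simp: mem_residue_iff)
qed

lemma coords_residue [simp]: "coords (residue p) = root_values p"
proof -
  have "(SOME q. q \<in> residue p) \<in> residue p" by (rule someI[of _ p]) (simp add: mem_residue_iff)
  then show ?thesis by (simp add: coords_def mem_residue_iff)
qed

lemma ideal_QX: "ideal (QX_ideal (chi n a)) ring_of_type_algebra"
  unfolding QX_ideal_def
  by (rule cring.cgenideal_ideal[OF cring_from_type_algebra]) (simp add: ring_of_type_algebra_def)

lemma QX_mod_simps:
  "carrier K = range residue"
  "\<one>\<^bsub>K\<^esub> = residue 1"
  "\<zero>\<^bsub>K\<^esub> = residue 0"
  "residue p \<oplus>\<^bsub>K\<^esub> residue q = residue (p + q)"
  "residue p \<otimes>\<^bsub>K\<^esub> residue q = residue (p * q)"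
proof -
  interpret ideal "QX_ideal (chi n a)" ring_of_type_algebra by (rule ideal_QX)
  note defs = QX_mod_def ring.defs module.defs FactRing_def Let_def residue_def
  show "carrier K = range residue"
    by (auto simp: defs A_RCOSETS_def RCOSETS_def a_r_coset_def ring_of_type_algebra_def)
  show "\<one>\<^bsub>K\<^esub> = residue 1" by (simp add: defs ring_of_type_algebra_def)
  have "residue 0 = QX_ideal (chi n a)"
  proof (rule Set.set_eqI)
    show "p \<in> residue 0 \<longleftrightarrow> p \<in> QX_ideal (chi n a)" for p
      unfolding mem_residue_iff QX_ideal_iff by (auto simp: root_values_def fun_eq_iff)
  qed
  then show "\<zero>\<^bsub>K\<^esub> = residue 0" by (simp add: defs)
  show "residue p \<oplus>\<^bsub>K\<^esub> residue q = residue (p + q)"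
    using a_rcos_sum[of p q] by (simp add: defs ring_of_type_algebra_def)
  show "residue p \<otimes>\<^bsub>K\<^esub> residue q = residue (p * q)"
    using rcoset_mult_add[of p q] by (simp add: defs ring_of_type_algebra_def)
qed

lemma coords_simps:
  "coords \<one>\<^bsub>K\<^esub> = (\<lambda>i. if i \<in> {1..n} then 1 else 0)"
  "coords \<zero>\<^bsub>K\<^esub> = (\<lambda>i. 0)"
  "A \<in> carrier K \<Longrightarrow> B \<in> carrier K \<Longrightarrow> coords (A \<oplus>\<^bsub>K\<^esub> B) = (\<lambda>i. coords A i + coords B i)"
  "A \<in> carrier K \<Longrightarrow> B \<in> carrier K \<Longrightarrow> coords (A \<otimes>\<^bsub>K\<^esub> B) = (\<lambda>i. coords A i * coords B i)"
  by (auto simp: QX_mod_simps root_values_def fun_eq_iff)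

lemma coords_inj: "inj_on coords (carrier K)"
  by (auto simp: inj_on_def QX_mod_simps residue_eq_iff)

lemma coords_outside: "A \<in> carrier K \<Longrightarrow> i \<notin> {1..n} \<Longrightarrow> coords A i = 0"
  by (auto simp: QX_mod_simps root_values_def)

lemma coords_surj:
  assumes "\<And>i. i \<notin> {1..n} \<Longrightarrow> v i = 0"
  obtains A where "A \<in> carrier K" "coords A = v"
proof -
  obtain p where "\<forall>i\<in>{1..n}. poly p (of_int (a i)) = v i"
    using interpolation[OF _ inj_roots] by blast
  then have "coords (residue p) = v" using assms by (auto simp: root_values_def fun_eq_iff)
  moreover have "residue p \<in> carrier K" by (simp add: QX_mod_simps)
  ultimately show thesis by (rule that[rotated])
qed

definition int_residue :: "int poly \<Rightarrow> int poly set" where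
  "int_residue r = PIdl\<^bsub>ring_of_type_algebra\<^esub> (chi n a) +>\<^bsub>ring_of_type_algebra\<^esub> r"

lemma carrier_ZX_mod: "carrier (ZX_mod (chi n a)) = range int_residue"
  by (auto simp: ZX_mod_def FactRing_def A_RCOSETS_def RCOSETS_def a_r_coset_def
      ring_of_type_algebra_def int_residue_def)

text \<open>
  In coordinates an integer polynomial acts through its values at the roots; hence an \<open>R\<close>-submodule
  of \<open>K\<close> is the same as a subgroup of \<open>\<rat>\<^sup>n\<close> stable under \<open>A\<close>.
\<close>

lemma smult_coords:
  assumes "A \<in> carrier K"
  shows "int_residue r \<odot>\<^bsub>K\<^esub> A \<in> carrier K"
    and "coords (int_residue r \<odot>\<^bsub>K\<^esub> A) = (\<lambda>i. of_int (poly r (a i)) * coords A i)"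
proof -
  obtain p where A: "A = residue p" using assms by (auto simp: QX_mod_simps)
  have root: "poly (chi n a) (a i) = 0" if "i \<in> {1..n}" for i
    using that by (auto simp: chi_def poly_prod)
  have "root_values (map_poly of_int q) = root_values (map_poly of_int r)" if "q \<in> int_residue r" for q
    using that root unfolding int_residue_def
    by (auto simp: a_r_coset_def r_coset_def cgenideal_def ring_of_type_algebra_def
        root_values_def poly_map_poly_of_int)
  moreover have "r \<in> int_residue r"
    unfolding int_residue_def
    by (auto simp: a_r_coset_def r_coset_def cgenideal_def ring_of_type_algebra_def
        intro!: exI[of _ 0])
  ultimately have "ZX_to_QX (chi n a) (int_residue r) = residue (map_poly of_int r)"
    unfolding ZX_to_QX_def residue_def[symmetric] using residue_eq_iff by blast
  moreover have "int_residue r \<odot>\<^bsub>K\<^esub> A = ZX_to_QX (chi n a) (int_residue r) \<otimes>\<^bsub>K\<^esub> A"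
    by (simp add: QX_mod_def Let_def ring.defs module.defs)
  ultimately have "int_residue r \<odot>\<^bsub>K\<^esub> A = residue (map_poly of_int r * p)"
    by (simp add: A QX_mod_simps)
  then show "int_residue r \<odot>\<^bsub>K\<^esub> A \<in> carrier K"
    "coords (int_residue r \<odot>\<^bsub>K\<^esub> A) = (\<lambda>i. of_int (poly r (a i)) * coords A i)"
    by (auto simp: A QX_mod_simps root_values_def fun_eq_iff poly_map_poly_of_int)
qed

end

section \<open>Fractional ideals as lattices\<close>

lemma lookup_free_Abelian_sum:
  "Poly_Mapping.lookup (\<Sum>k<n::nat. frag_cmul (m k) (frag_of k)) k = (if k < n then m k else 0)"
  by (auto simp: lookup_sum if_distrib[of "\<lambda>x. _ * x"] cong: if_cong)

lemma free_Abelian_expansion: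
  assumes "Poly_Mapping.keys c \<subseteq> {..<n::nat}"
  shows "c = (\<Sum>k<n. frag_cmul (Poly_Mapping.lookup c k) (frag_of k))"
proof (rule poly_mapping_eqI)
  fix k
  have "Poly_Mapping.lookup c k = 0" if "\<not> k < n"
    using assms that by (meson in_keys_iff lessThan_iff subsetD)
  then show "Poly_Mapping.lookup c k =
      Poly_Mapping.lookup (\<Sum>k<n. frag_cmul (Poly_Mapping.lookup c k) (frag_of k)) k"
    by (simp add: lookup_free_Abelian_sum)
qed

lemma keys_free_Abelian_sum: "Poly_Mapping.keys (\<Sum>k<n::nat. frag_cmul (m k) (frag_of k)) \<subseteq> {..<n}"
  by (auto simp: lookup_free_Abelian_sum in_keys_iff split: if_splits)

text \<open>
  This turns the abstract isomorphism in the definition of a fractional ideal into generators of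
  the lattice, to which \<open>triangular_basis\<close> applies.
\<close>

lemma additive_image_of_free_group:
  fixes \<Phi> :: "(nat \<Rightarrow>\<^sub>0 int) \<Rightarrow> nat \<Rightarrow> rat"
  assumes add: "\<And>c c'. Poly_Mapping.keys c \<subseteq> {..<n} \<Longrightarrow> Poly_Mapping.keys c' \<subseteq> {..<n} \<Longrightarrow>
      \<Phi> (c + c') = (\<lambda>i. \<Phi> c i + \<Phi> c' i)"
    and inj: "inj_on \<Phi> {c. Poly_Mapping.keys c \<subseteq> {..<n}}"
  defines "B \<equiv> \<lambda>k. \<Phi> (frag_of k)"
  shows "\<Phi> ` {c. Poly_Mapping.keys c \<subseteq> {..<n}} = range (int_comb n B)"
    and "int_comb n B m = (\<lambda>_. 0) \<Longrightarrow> k < n \<Longrightarrow> m k = 0"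
proof -
  have zero: "\<Phi> 0 = (\<lambda>_. 0)" using add[of 0 0] by (auto simp: fun_eq_iff)
  have cmul: "\<Phi> (frag_cmul z (frag_of k)) = (\<lambda>i. of_int z * B k i)" if k: "k < n" for z k
  proof -
    have keys: "Poly_Mapping.keys (frag_cmul z (frag_of k)) \<subseteq> {..<n}" for z
      using k keys_cmul[of z "frag_of k"] by auto
    show ?thesis
    proof (induction z rule: int_induct[where k = 0])
      case base
      then show ?case by (simp add: zero)
    next
      case (step1 z)
      have "\<Phi> (frag_cmul (z + 1) (frag_of k)) = (\<lambda>i. \<Phi> (frag_cmul z (frag_of k)) i + \<Phi> (frag_of k) i)"
        using add[OF keys[of z] keys[of 1]] by (simp add: frag_cmul_distrib)
      then show ?case by (simp add: step1.IH B_def distrib_right)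
    next
      case (step2 z)
      have "\<Phi> (frag_cmul (z - 1) (frag_of k) + frag_of k) =
          (\<lambda>i. \<Phi> (frag_cmul (z - 1) (frag_of k)) i + \<Phi> (frag_of k) i)"
        using add[OF keys[of "z - 1"] keys[of 1]] by simp
      moreover have "frag_cmul (z - 1) (frag_of k) + frag_of k = frag_cmul z (frag_of k)"
        by (simp add: frag_cmul_diff_distrib)
      ultimately have "(\<lambda>i. of_int z * B k i) = (\<lambda>i. \<Phi> (frag_cmul (z - 1) (frag_of k)) i + B k i)"
        by (simp add: step2.IH B_def)
      then show ?case by (auto simp: fun_eq_iff algebra_simps)
    qed
  qed
  have \<Phi>_sum: "\<Phi> (\<Sum>k<n. frag_cmul (m k) (frag_of k)) = int_comb n B m" for m
  proof -
    have "\<Phi> (\<Sum>k<j. frag_cmul (m k) (frag_of k)) = int_comb j B m" if "j \<le> n" for j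
      using that
    proof (induction j)
      case 0
      then show ?case by (simp add: zero int_comb_def)
    next
      case (Suc j)
      have keys: "Poly_Mapping.keys (\<Sum>k<j. frag_cmul (m k) (frag_of k)) \<subseteq> {..<n}"
        "Poly_Mapping.keys (frag_cmul (m j) (frag_of j)) \<subseteq> {..<n}"
        using Suc.prems keys_free_Abelian_sum[of m j] keys_cmul[of "m j" "frag_of j"] by fastforce+
      show ?case
        using add[OF keys] Suc cmul[of j "m j"] by (simp add: int_comb_def)
    qed
    then show ?thesis by blast
  qed
  show "\<Phi> ` {c. Poly_Mapping.keys c \<subseteq> {..<n}} = range (int_comb n B)"
  proof (intro equalityI subsetI)
    fix v assume "v \<in> \<Phi> ` {c. Poly_Mapping.keys c \<subseteq> {..<n}}"
    then obtain c where "Poly_Mapping.keys c \<subseteq> {..<n}" "v = \<Phi> c" by blast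
    then have "v = int_comb n B (Poly_Mapping.lookup c)"
      using free_Abelian_expansion[of c n] \<Phi>_sum by metis
    then show "v \<in> range (int_comb n B)" by blast
  next
    fix v assume "v \<in> range (int_comb n B)"
    then show "v \<in> \<Phi> ` {c. Poly_Mapping.keys c \<subseteq> {..<n}}"
      using keys_free_Abelian_sum \<Phi>_sum by (metis (mono_tags, lifting) imageE image_eqI mem_Collect_eq)
  qed
  show "m k = 0" if m: "int_comb n B m = (\<lambda>_. 0)" and k: "k < n" for m k
  proof -
    have "(\<Sum>k<n. frag_cmul (m k) (frag_of k)) = 0"
      by (rule inj_onD[OF inj]) (use \<Phi>_sum[of m] m zero keys_free_Abelian_sum[of m n] in auto)
    then show ?thesis using lookup_free_Abelian_sum[of m n k] k by simp
  qed
qed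

lemma comb_add: "comb n P m i + of_int c * comb n P m' i = comb n P (\<lambda>j. m j + c * m' j) i"
  by (simp add: comb_def sum_distrib_left distrib_left sum.distrib mult.assoc mult.left_commute)

lemma comb_inj:
  assumes P: "nonsingular n P" and eq: "comb n P m = comb n P m'" and j: "j \<in> {1..n}"
  shows "m j = m' j"
proof -
  have "rat_of_int (m j - m' j) = 0"
  proof (rule triangular_system_injective[where P = P and k = 1 and n = n and x = "\<lambda>j. rat_of_int (m j - m' j)"])
    show "(\<Sum>l\<in>{i..n}. P i l * of_int (m l - m' l)) = 0" if "i \<in> {1..n}" for i
      using fun_cong[OF eq, of i] that
      by (simp add: comb_def right_diff_distrib sum_subtractf)
  qed (use P j in \<open>auto simp: nonsingular_def\<close>)
  then show ?thesis by simp
qed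

context increasing_roots
begin

lemma add_group: "Group.group (add_monoid K)"
proof (rule groupI)
  fix A assume "A \<in> carrier (add_monoid K)"
  then obtain p where "A = residue p" by (auto simp: QX_mod_simps)
  then have "residue (- p) \<in> carrier (add_monoid K)"
    "residue (- p) \<otimes>\<^bsub>add_monoid K\<^esub> A = \<one>\<^bsub>add_monoid K\<^esub>"
    by (simp_all add: QX_mod_simps)
  then show "\<exists>C\<in>carrier (add_monoid K). C \<otimes>\<^bsub>add_monoid K\<^esub> A = \<one>\<^bsub>add_monoid K\<^esub>" by blast
qed (auto simp: QX_mod_simps add.assoc)

lemma coords_inv:
  assumes "A \<in> carrier K"
  shows "coords (inv\<^bsub>add_monoid K\<^esub> A) = (\<lambda>i. - coords A i)"
proof -
  obtain p where p: "A = residue p" using assms by (auto simp: QX_mod_simps)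
  have "inv\<^bsub>add_monoid K\<^esub> A = residue (- p)"
    by (rule group.inv_equality[OF add_group]) (simp_all add: QX_mod_simps p)
  then show ?thesis by (auto simp: p root_values_def)
qed

lemma fractional_ideal_has_type:
  assumes I: "fractional_ideal (chi n a) I"
  shows "I \<subseteq> carrier K" "\<exists>T\<in>reduced n a. has_type n a (coords ` I) T"
proof -
  let ?G = "(add_monoid K)\<lparr>carrier := I\<rparr>" and ?F = "free_Abelian_group {..<n}"
  have sub: "submodule I (ZX_mod (chi n a)) K" and iso: "?G \<cong> ?F"
    using I by (auto simp: fractional_ideal_def degree_chi)
  interpret submodule I "ZX_mod (chi n a)" K by (rule sub)
  show IK: "I \<subseteq> carrier K" using subset by simp
  have "group ?G" by (rule subgroup_is_group[OF add_group])
  then have "?F \<cong> ?G" using iso by (rule group.iso_sym)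
  then obtain \<psi> where \<psi>: "\<psi> \<in> hom ?F ?G" "bij_betw \<psi> (carrier ?F) (carrier ?G)"
    by (auto simp: is_iso_def Group.iso_def)
  have carr: "carrier ?F = {c. Poly_Mapping.keys c \<subseteq> {..<n}}" by auto
  have im: "\<psi> ` {c. Poly_Mapping.keys c \<subseteq> {..<n}} = I"
    using \<psi>(2) unfolding carr bij_betw_def by simp
  define \<Phi> where "\<Phi> = coords \<circ> \<psi>"
  have add: "\<Phi> (c + c') = (\<lambda>i. \<Phi> c i + \<Phi> c' i)"
    if c: "Poly_Mapping.keys c \<subseteq> {..<n}" "Poly_Mapping.keys c' \<subseteq> {..<n}" for c c'
  proof -
    have "\<psi> (c + c') = \<psi> c \<oplus>\<^bsub>K\<^esub> \<psi> c'" using hom_mult[OF \<psi>(1), of c c'] c by simp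
    moreover have "\<psi> c \<in> carrier K" "\<psi> c' \<in> carrier K" using im IK c by auto
    ultimately show ?thesis by (simp add: \<Phi>_def coords_simps)
  qed
  have inj: "inj_on \<Phi> {c. Poly_Mapping.keys c \<subseteq> {..<n}}"
    unfolding \<Phi>_def
  proof (rule comp_inj_on)
    show "inj_on \<psi> {c. Poly_Mapping.keys c \<subseteq> {..<n}}" using \<psi>(2) unfolding carr bij_betw_def by blast
    show "inj_on coords (\<psi> ` {c. Poly_Mapping.keys c \<subseteq> {..<n}})"
      using coords_inj IK unfolding im by (rule inj_on_subset)
  qed
  define B where "B = (\<lambda>k. \<Phi> (frag_of k))"
  have range: "coords ` I = range (int_comb n B)"
    using additive_image_of_free_group(1)[of n \<Phi>, OF add inj] im
    by (simp add: \<Phi>_def B_def image_comp flip: image_image)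
  have "\<exists>P. nonsingular n P \<and> range (int_comb n B) = range (comb n P)"
  proof (rule triangular_basis)
    show "m k = 0" if "int_comb n B m = (\<lambda>_. 0)" "k < n" for m k
      using additive_image_of_free_group(2)[of n \<Phi> m k, OF add inj] that by (simp add: B_def)
    show "B k i = 0" if "k < n" "i \<notin> {1..n}" for k i
    proof -
      have "frag_of k \<in> {c. Poly_Mapping.keys c \<subseteq> {..<n}}" using that by simp
      then have "\<psi> (frag_of k) \<in> carrier K" using im IK by blast
      then show ?thesis using that coords_outside by (simp add: B_def \<Phi>_def)
    qed
  qed
  then obtain P where P: "nonsingular n P" "coords ` I = range (comb n P)" unfolding range by blast
  have "(\<lambda>i. of_int (a i) * v i) \<in> coords ` I" if v: "v \<in> coords ` I" for v
  proof -
    obtain A where A: "A \<in> I" "v = coords A" using v by blast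
    \<comment> \<open>The class of the indeterminate multiplies the \<open>i\<close>-th coordinate by \<open>a i\<close>.\<close>
    define x where "x = int_residue [:0, 1:]"
    have xR: "x \<in> carrier (ZX_mod (chi n a))" by (simp add: x_def carrier_ZX_mod)
    have "coords (x \<odot>\<^bsub>K\<^esub> A) = (\<lambda>i. of_int (poly [:0, 1:] (a i)) * coords A i)"
      unfolding x_def by (rule smult_coords(2)) (use A IK in blast)
    then have "(\<lambda>i. of_int (a i) * v i) = coords (x \<odot>\<^bsub>K\<^esub> A)" by (simp add: A)
    then show ?thesis using smult_closed[OF xR A(1)] by blast
  qed
  then show "\<exists>T\<in>reduced n a. has_type n a (coords ` I) T"
    using stable_lattice_has_type[OF P(1)] unfolding P(2) by blast
qed

text \<open>
  The columns of a nonsingular \<open>P\<close> are independent, so the map from the free abelian group on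
  \<open>{..<n}\<close> that sends the generator \<open>k\<close> to the column \<open>k + 1\<close> is an isomorphism onto the lattice.
\<close>

lemma lattice_is_fractional_ideal:
  assumes L: "has_type n a L T"
  shows "\<exists>I. fractional_ideal (chi n a) I \<and> coords ` I = L"
proof -
  obtain P where P: "nonsingular n P" "L = range (comb n P)"
    using L unfolding has_type_def by blast
  have lin: "(\<lambda>i. u i + of_int c * v i) \<in> L" if uv: "u \<in> L" "v \<in> L" for u v c
  proof -
    obtain m m' where "u = comb n P m" "v = comb n P m'" using uv P by auto
    then have "(\<lambda>i. u i + of_int c * v i) = comb n P (\<lambda>k. m k + c * m' k)"
      by (auto simp: comb_add)
    then show ?thesis by (auto simp: P)
  qed
  have zero: "(\<lambda>_. 0) \<in> L"
    unfolding P(2) by (rule range_eqI[of _ _ "\<lambda>_. 0"]) (auto simp: comb_def)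
  have poly_stable: "(\<lambda>i. of_int (poly r (a i)) * v i) \<in> L" if "v \<in> L" for v r
  proof (induction r)
    case 0
    then show ?case using zero by simp
  next
    case (pCons c r)
    have "(\<lambda>i. of_int (a i) * (of_int (poly r (a i)) * v i)) \<in> L"
      by (rule has_type_stable[OF L pCons.IH])
    from lin[OF this \<open>v \<in> L\<close>, of c] show ?case by (simp add: algebra_simps)
  qed
  \<comment> \<open>The full preimage of \<open>L\<close> under the injective map \<open>coords\<close>.\<close>
  define I where "I = {A \<in> carrier K. coords A \<in> L}"
  have coords_I: "coords ` I = L"
  proof (intro equalityI subsetI)
    fix v assume v: "v \<in> L"
    then have "v i = 0" if "i \<notin> {1..n}" for i
      using that unfolding P(2) comb_def by auto
    then obtain A where "A \<in> carrier K" "coords A = v" using coords_surj by blast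
    then show "v \<in> coords ` I" using v unfolding I_def by blast
  qed (auto simp: I_def)
  have "submodule I (ZX_mod (chi n a)) K"
  proof (intro submodule.intro subgroup.intro submodule_axioms.intro)
    show "I \<subseteq> carrier (add_monoid K)" by (auto simp: I_def)
    show "A \<otimes>\<^bsub>add_monoid K\<^esub> C \<in> I" if "A \<in> I" "C \<in> I" for A C
    proof -
      have "A \<oplus>\<^bsub>K\<^esub> C \<in> carrier K" using that by (auto simp: I_def QX_mod_simps)
      moreover have "coords (A \<oplus>\<^bsub>K\<^esub> C) \<in> L"
        using that lin[of "coords A" "coords C" 1] by (simp add: I_def coords_simps)
      ultimately show ?thesis by (simp add: I_def)
    qed
    show "\<one>\<^bsub>add_monoid K\<^esub> \<in> I" using zero coords_simps(2) by (simp add: I_def) (simp add: QX_mod_simps)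
    show "inv\<^bsub>add_monoid K\<^esub> A \<in> I" if "A \<in> I" for A
    proof -
      have A: "A \<in> carrier K" "coords A \<in> L" using that by (auto simp: I_def)
      then have "inv\<^bsub>add_monoid K\<^esub> A \<in> carrier K" using group.inv_closed[OF add_group, of A] by simp
      moreover have "coords (inv\<^bsub>add_monoid K\<^esub> A) \<in> L"
        using lin[OF zero A(2), of "-1"] coords_inv[OF A(1)] by simp
      ultimately show ?thesis by (simp add: I_def)
    qed
    show "x \<odot>\<^bsub>K\<^esub> A \<in> I" if x: "x \<in> carrier (ZX_mod (chi n a))" and A: "A \<in> I" for x A
    proof -
      obtain r where "x = int_residue r" using x unfolding carrier_ZX_mod by blast
      then show ?thesis using A smult_coords[of A r] poly_stable[of "coords A" r] by (simp add: I_def)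
    qed
  qed
  moreover have "(add_monoid K)\<lparr>carrier := I\<rparr> \<cong> free_Abelian_group {..<Polynomial.degree (chi n a)}"
    (is "?G \<cong> _")
  proof -
    let ?F = "free_Abelian_group {..<n}"
    \<comment> \<open>Generators are numbered from \<open>0\<close>, columns from \<open>1\<close>.\<close>
    define m where "m c = (\<lambda>j. Poly_Mapping.lookup c (j - 1))" for c :: "nat \<Rightarrow>\<^sub>0 int"
    have "\<exists>A. A \<in> I \<and> coords A = comb n P (m c)" for c
      using coords_I unfolding P(2) by (metis (no_types, lifting) imageE rangeI)
    then obtain \<theta> where \<theta>: "\<And>c. \<theta> c \<in> I" "\<And>c. coords (\<theta> c) = comb n P (m c)" by metis
    have inK: "A \<in> carrier K" if "A \<in> I" for A using that by (simp add: I_def)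
    have "\<theta> \<in> iso ?F ?G"
    proof (rule isoI)
      show "\<theta> \<in> hom ?F ?G"
      proof (rule homI)
        fix c c' assume "c \<in> carrier ?F" "c' \<in> carrier ?F"
        have "coords (\<theta> (c + c')) = coords (\<theta> c \<oplus>\<^bsub>K\<^esub> \<theta> c')"
          using comb_add[of n P "m c" _ 1 "m c'"]
          by (simp add: coords_simps \<theta> inK) (simp add: m_def lookup_add)
        moreover have "\<theta> c \<oplus>\<^bsub>K\<^esub> \<theta> c' \<in> carrier K"
          using inK[OF \<theta>(1)[of c]] inK[OF \<theta>(1)[of c']] by (auto simp: QX_mod_simps)
        ultimately have "\<theta> (c + c') = \<theta> c \<oplus>\<^bsub>K\<^esub> \<theta> c'"
          using coords_inj \<theta>(1) inK by (auto dest: inj_onD)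
        then show "\<theta> (c \<otimes>\<^bsub>?F\<^esub> c') = \<theta> c \<otimes>\<^bsub>?G\<^esub> \<theta> c'" by simp
      qed (simp add: \<theta>)
      have "inj_on \<theta> (carrier ?F)"
      proof (rule inj_onI)
        fix c c' assume c: "c \<in> carrier ?F" "c' \<in> carrier ?F" and "\<theta> c = \<theta> c'"
        then have eq: "comb n P (m c) = comb n P (m c')" using \<theta>(2) by metis
        have "Poly_Mapping.lookup c k = Poly_Mapping.lookup c' k" if "k < n" for k
          using comb_inj[OF P(1) eq, of "Suc k"] that by (simp add: m_def)
        then show "c = c'" using c free_Abelian_expansion[of c n] free_Abelian_expansion[of c' n] by simp
      qed
      moreover have "\<theta> ` carrier ?F = I"
      proof (intro equalityI subsetI)
        fix A assume A: "A \<in> I"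
        then obtain x where x: "coords A = comb n P x" using coords_I unfolding P(2) by blast
        define c where "c = (\<Sum>k<n. frag_cmul (x (Suc k)) (frag_of k))"
        have "comb n P (m c) = comb n P x"
          unfolding comb_def m_def c_def
          by (auto simp: lookup_free_Abelian_sum fun_eq_iff intro!: sum.cong)
        then have "coords (\<theta> c) = coords A" by (simp add: \<theta> x)
        then have "\<theta> c = A" using coords_inj \<theta>(1) inK A by (auto dest: inj_onD)
        then show "A \<in> \<theta> ` carrier ?F" 
          using keys_free_Abelian_sum[of "\<lambda>k. x (Suc k)" n]
          by (intro image_eqI[of _ _ c]) (simp_all add: c_def)
      qed (use \<theta> in auto)
      ultimately show "bij_betw \<theta> (carrier ?F) (carrier ?G)" by (simp add: bij_betw_def)
    qed
    then show ?thesis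
      using group.iso_sym[OF group_free_Abelian_group] unfolding is_iso_def degree_chi by blast
  qed
  ultimately show ?thesis using coords_I unfolding fractional_ideal_def by blast
qed

text \<open>
  A unit of \<open>K\<close> is an element all of whose coordinates are nonzero.
\<close>

lemma equiv_iff_scale:
  "(I, J) \<in> fractional_ideal_equiv (chi n a) \<longleftrightarrow>
     fractional_ideal (chi n a) I \<and> fractional_ideal (chi n a) J \<and>
     (\<exists>d. (\<forall>i\<in>{1..n}. d i \<noteq> 0) \<and> coords ` I = scale d (coords ` J))"
proof -
  have "(\<exists>k\<in>Units K. I = k <#\<^bsub>K\<^esub> J) \<longleftrightarrow> (\<exists>d. (\<forall>i\<in>{1..n}. d i \<noteq> 0) \<and> coords ` I = scale d (coords ` J))"
    if I: "I \<subseteq> carrier K" and J: "J \<subseteq> carrier K"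
  proof -
    have coset: "coords ` (k <#\<^bsub>K\<^esub> J) = scale (coords k) (coords ` J)" if "k \<in> carrier K" for k
      using that J by (force simp: l_coset_def scale_def coords_simps image_iff)
    show ?thesis
    proof
      assume "\<exists>k\<in>Units K. I = k <#\<^bsub>K\<^esub> J"
      then obtain k l where k: "k \<in> carrier K" "I = k <#\<^bsub>K\<^esub> J" "l \<in> carrier K" "l \<otimes>\<^bsub>K\<^esub> k = \<one>\<^bsub>K\<^esub>"
        by (auto simp: Units_def)
      have "coords l i * coords k i = 1" if "i \<in> {1..n}" for i
        using fun_cong[OF coords_simps(4)[OF k(3,1)], of i] that unfolding k(4) coords_simps(1) by simp
      then have "\<forall>i\<in>{1..n}. coords k i \<noteq> 0" by force
      then show "\<exists>d. (\<forall>i\<in>{1..n}. d i \<noteq> 0) \<and> coords ` I = scale d (coords ` J)"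
        using coset[OF k(1)] k(2) by blast
    next
      assume "\<exists>d. (\<forall>i\<in>{1..n}. d i \<noteq> 0) \<and> coords ` I = scale d (coords ` J)"
      then obtain d where d: "\<And>i. i \<in> {1..n} \<Longrightarrow> d i \<noteq> 0" "coords ` I = scale d (coords ` J)" by blast
      obtain k where k: "k \<in> carrier K" "coords k = (\<lambda>i. if i \<in> {1..n} then d i else 0)"
        by (rule coords_surj[of "\<lambda>i. if i \<in> {1..n} then d i else 0"]) (auto split: if_splits)
      obtain l where l: "l \<in> carrier K" "coords l = (\<lambda>i. if i \<in> {1..n} then inverse (d i) else 0)"
        by (rule coords_surj[of "\<lambda>i. if i \<in> {1..n} then inverse (d i) else 0"]) (auto split: if_splits)
      have closed: "k \<otimes>\<^bsub>K\<^esub> l \<in> carrier K" "l \<otimes>\<^bsub>K\<^esub> k \<in> carrier K" "\<one>\<^bsub>K\<^esub> \<in> carrier K"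
        using k(1) l(1) by (auto simp: QX_mod_simps)
      have "coords (k \<otimes>\<^bsub>K\<^esub> l) = coords \<one>\<^bsub>K\<^esub>" "coords (l \<otimes>\<^bsub>K\<^esub> k) = coords \<one>\<^bsub>K\<^esub>"
        unfolding coords_simps(1) coords_simps(4)[OF k(1) l(1)] coords_simps(4)[OF l(1) k(1)] k(2) l(2)
        using d(1) by (auto simp: fun_eq_iff)
      then have "k \<otimes>\<^bsub>K\<^esub> l = \<one>\<^bsub>K\<^esub>" "l \<otimes>\<^bsub>K\<^esub> k = \<one>\<^bsub>K\<^esub>"
        using closed by (auto dest: inj_onD[OF coords_inj])
      then have unit: "k \<in> Units K" using k(1) l(1) by (auto simp: Units_def)
      have "scale (coords k) (coords ` J) = scale d (coords ` J)"
        unfolding scale_def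
      proof (rule image_cong)
        fix v assume "v \<in> coords ` J"
        then show "(\<lambda>i. coords k i * v i) = (\<lambda>i. d i * v i)"
          using J coords_outside by (auto simp: k(2) fun_eq_iff)
      qed simp
      then have "coords ` I = coords ` (k <#\<^bsub>K\<^esub> J)" using coset[OF k(1)] d(2) by simp
      moreover have "k <#\<^bsub>K\<^esub> J \<subseteq> carrier K"
        using k(1) J by (auto simp: l_coset_def QX_mod_simps)
      ultimately have "I = k <#\<^bsub>K\<^esub> J"
        using inj_on_image_eq_iff[OF coords_inj I] by blast
      then show "\<exists>k\<in>Units K. I = k <#\<^bsub>K\<^esub> J" using unit by blast
    qed
  qed
  then show ?thesis
    using fractional_ideal_has_type(1) unfolding fractional_ideal_equiv_def by blast
qed

end

section \<open>Counting ideal classes\<close>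

definition pairs :: "nat \<Rightarrow> (nat \<times> nat) set" where
  "pairs n = {(i, j). 1 \<le> i \<and> i < j \<and> j \<le> n}"

lemma finite_pairs [simp]: "finite (pairs n)"
  by (rule finite_subset[of _ "{1..n} \<times> {1..n}"]) (auto simp: pairs_def)

text \<open>
  The diagonals of \<open>g\<close> and \<open>-g\<close> lead to the same conjugate, so one of each pair of opposite sign
  vectors is selected.
\<close>

definition sign_choices :: "nat \<Rightarrow> (nat \<Rightarrow> int) set" where
  "sign_choices n = PiE {1..n} (\<lambda>i. if i = 1 then {1} else {1, - 1})"

lemma finite_sign_choices: "finite (sign_choices n)"
  unfolding sign_choices_def by (rule finite_PiE) auto

lemma card_sign_choices:
  assumes "n \<ge> 1"
  shows "card (sign_choices n) = 2 ^ (n - 1)"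
proof -
  have "card (sign_choices n) = (\<Prod>i\<in>{1..n}. if i = 1 then 1 else 2)"
    unfolding sign_choices_def by (subst card_PiE) (auto intro!: prod.cong)
  also have "{1..n} = insert 1 {2..n}" using assms by auto
  also have "(\<Prod>i\<in>insert 1 {2..n}. if i = 1 then 1 else 2) = (\<Prod>i\<in>{2..n}. 2 :: nat)"
    by (subst prod.insert) (auto intro!: prod.cong)
  also have "\<dots> = 2 ^ (n - 1)" by simp
  finally show ?thesis .
qed

lemma sign_choices_sign_vector: "s \<in> sign_choices n \<Longrightarrow> sign_vector n s"
  by (fastforce simp: sign_choices_def sign_vector_def PiE_iff split: if_splits)

lemma sign_choices_first:
  assumes "s \<in> sign_choices n" "n \<ge> 1"
  shows "s 1 = 1"
  using PiE_mem[OF assms(1)[unfolded sign_choices_def], of 1] assms(2) by simp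

text \<open>
  Fibres without exceptional elements have exactly \<open>N\<close> elements; each of the others contains an
  exceptional element, so there are at most \<open>card E\<close> of them.
\<close>

lemma fibre_count_bounds:
  assumes fin: "finite V" and E: "E \<subseteq> V"
    and le: "\<And>x. x \<in> V \<Longrightarrow> card {y \<in> V. F y = F x} \<le> N"
    and eq: "\<And>x. x \<in> V - E \<Longrightarrow> card {y \<in> V. F y = F x} = N"
  shows "card V \<le> N * card (F ` V)" "N * card (F ` V) \<le> card V + N * card E"
proof -
  have count: "card A = (\<Sum>c\<in>F ` V. card {y \<in> A. F y = c})" if "A \<subseteq> V" for A
  proof -
    have "card A = (\<Sum>c\<in>F ` V. \<Sum>y | y \<in> A \<and> F y = c. 1)"
      unfolding card_eq_sum using that fin
      by (subst sum.group) (auto intro: finite_subset)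
    then show ?thesis by simp
  qed
  have "(\<Sum>c\<in>F ` V. card {y \<in> V. F y = c}) \<le> (\<Sum>c\<in>F ` V. N)"
    by (rule sum_mono) (use le in auto)
  then show "card V \<le> N * card (F ` V)" using count[of V] by (simp add: mult.commute)
  have "N \<le> card {y \<in> V. F y = c} + N * card {y \<in> E. F y = c}" if "c \<in> F ` V" for c
  proof -
    obtain x where x: "x \<in> V" "c = F x" using \<open>c \<in> F ` V\<close> by blast
    show ?thesis
    proof (cases "x \<in> E")
      case True
      then have "x \<in> {y \<in> E. F y = c}" using x by simp
      moreover have "finite {y \<in> E. F y = c}" using E fin by (auto intro: finite_subset)
      ultimately have "card {y \<in> E. F y = c} \<ge> 1" by (metis One_nat_def Suc_leI card_gt_0_iff empty_iff)
      then show ?thesis by (metis mult_le_mono2 nat_mult_1_right trans_le_add2)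
    qed (use x eq[of x] in auto)
  qed
  then have "(\<Sum>c\<in>F ` V. N) \<le> (\<Sum>c\<in>F ` V. card {y \<in> V. F y = c} + N * card {y \<in> E. F y = c})"
    by (rule sum_mono)
  also have "\<dots> = card V + N * card E"
    using count[of V] count[OF E] by (simp add: sum.distrib flip: sum_distrib_left)
  finally show "N * card (F ` V) \<le> card V + N * card E" by (simp add: mult.commute)
qed

context increasing_roots
begin

lemma reduced_determined:
  "inj_on (\<lambda>T. restrict (\<lambda>(i, j). T i j) (pairs n)) (reduced n a)"
proof (rule inj_onI)
  fix T S assume T: "T \<in> reduced n a" "S \<in> reduced n a"
    and eq: "restrict (\<lambda>(i, j). T i j) (pairs n) = restrict (\<lambda>(i, j). S i j) (pairs n)"
  show "T = S"
  proof (rule reduced_eqI[OF T])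
    fix i j assume "1 \<le> i" "i < j" "j \<le> n"
    then show "T i j = S i j" using fun_cong[OF eq, of "(i, j)"] by (simp add: pairs_def)
  qed
qed

lemma image_reduced:
  "(\<lambda>T. restrict (\<lambda>(i, j). T i j) (pairs n)) ` reduced n a = PiE (pairs n) (\<lambda>(i, j). {0..<a j - a i})"
proof (intro equalityI subsetI)
  fix t assume t: "t \<in> PiE (pairs n) (\<lambda>(i, j). {0..<a j - a i})"
  define T where "T i j = (if 1 \<le> i \<and> i < j \<and> j \<le> n then t (i, j) else if i = j then a i else 0)" for i j
  have "t (i, j) \<in> {0..<a j - a i}" if "1 \<le> i" "i < j" "j \<le> n" for i j
    using PiE_mem[OF t, of "(i, j)"] that by (simp add: pairs_def)
  then have "T \<in> reduced n a" by (auto simp: reduced_def T_def)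
  moreover have "restrict (\<lambda>(i, j). T i j) (pairs n) = t"
    using t by (auto simp: T_def pairs_def restrict_def fun_eq_iff PiE_iff extensional_def)
  ultimately show "t \<in> (\<lambda>T. restrict (\<lambda>(i, j). T i j) (pairs n)) ` reduced n a" by blast
next
  fix t assume "t \<in> (\<lambda>T. restrict (\<lambda>(i, j). T i j) (pairs n)) ` reduced n a"
  then obtain T where T: "T \<in> reduced n a" "t = restrict (\<lambda>(i, j). T i j) (pairs n)" by blast
  show "t \<in> PiE (pairs n) (\<lambda>(i, j). {0..<a j - a i})"
    unfolding T(2) by (rule restrict_PiE_iff[THEN iffD2])
      (use reduced_bounds[OF T(1)] in \<open>auto simp: pairs_def\<close>)
qed

lemma Delta_pairs: "Delta n a = (\<Prod>(i, j)\<in>pairs n. a j - a i)"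
  by (simp add: Delta_def pairs_def)

lemma finite_reduced: "finite (reduced n a)"
proof -
  have "finite (PiE (pairs n) (\<lambda>(i, j). {0..<a j - a i}))" by (rule finite_PiE) auto
  then show ?thesis unfolding image_reduced[symmetric] using finite_imageD reduced_determined by blast
qed

lemma card_reduced: "int (card (reduced n a)) = Delta n a"
proof -
  have "card (reduced n a) = card (PiE (pairs n) (\<lambda>(i, j). {0..<a j - a i}))"
    unfolding image_reduced[symmetric] using card_image[OF reduced_determined] by simp
  also have "\<dots> = (\<Prod>(i, j)\<in>pairs n. nat (a j - a i))"
    by (simp add: card_PiE case_prod_beta)
  also have "int \<dots> = (\<Prod>(i, j)\<in>pairs n. a j - a i)"
    unfolding of_nat_prod
    by (rule prod.cong) (use gap_pos in \<open>auto simp: pairs_def less_imp_le\<close>)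
  finally show ?thesis by (simp add: Delta_pairs)
qed

text \<open>
  The code keeps the entries that a collision does not constrain and records only the relevant half
  of the interval for the others.
\<close>

lemma card_collisions:
  assumes s: "sign_vector n s" "sign_vector n s'"
  shows "int (card {T \<in> reduced n a. collides s s' T}) \<le>
    (\<Prod>(i, j)\<in>pairs n. if s i * s j = s' i * s' j then a j - a i else 2)"
proof -
  define C :: "nat \<times> nat \<Rightarrow> int set" where
    "C = (\<lambda>(i, j). if s i * s j = s' i * s' j then {0..<a j - a i} else {0, 1})"
  define code where "code T = restrict (\<lambda>(i, j). if s i * s j = s' i * s' j then T i j
      else if 2 * T i j < a j - a i then 0 else 1) (pairs n)" for T :: "nat \<Rightarrow> nat \<Rightarrow> int"
  have "card {T \<in> reduced n a. collides s s' T} \<le> card (PiE (pairs n) C)"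
  proof (rule card_inj_on_le)
    show "inj_on code {T \<in> reduced n a. collides s s' T}"
    proof (rule inj_onI)
      fix T S assume T: "T \<in> {T \<in> reduced n a. collides s s' T}"
        and S: "S \<in> {T \<in> reduced n a. collides s s' T}" and eq: "code T = code S"
      have code: "(if s i * s j = s' i * s' j then T i j else if 2 * T i j < a j - a i then 0 else 1) =
          (if s i * s j = s' i * s' j then S i j else if 2 * S i j < a j - a i then 0 else 1)"
        if "1 \<le> i" "i < j" "j \<le> n" for i j
        using fun_cong[OF eq, of "(i, j)"] that by (simp add: code_def pairs_def)
      show "T = S"
      proof (rule collision_determined[OF s])
        show "T i j = S i j" if "1 \<le> i" "i < j" "j \<le> n" "s i * s j = s' i * s' j" for i j
          using code[OF that(1-3)] that(4) by simp
        show "2 * T i j < a j - a i \<longleftrightarrow> 2 * S i j < a j - a i"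
          if "1 \<le> i" "i < j" "j \<le> n" "s i * s j \<noteq> s' i * s' j" for i j
          using code[OF that(1-3)] that(4) by (simp split: if_splits)
      qed (use T S in auto)
    qed
    show "code ` {T \<in> reduced n a. collides s s' T} \<subseteq> PiE (pairs n) C"
    proof (intro image_subsetI)
      fix T assume "T \<in> {T \<in> reduced n a. collides s s' T}"
      then have T: "T \<in> reduced n a" by simp
      show "code T \<in> PiE (pairs n) C"
        unfolding code_def by (rule restrict_PiE_iff[THEN iffD2])
          (use reduced_bounds[OF T] in \<open>auto simp: pairs_def C_def\<close>)
    qed
    show "finite (PiE (pairs n) C)" by (rule finite_PiE) (auto simp: C_def)
  qed
  also have "card (PiE (pairs n) C) = (\<Prod>(i, j)\<in>pairs n. if s i * s j = s' i * s' j then nat (a j - a i) else 2)"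
    by (subst card_PiE) (auto simp: C_def intro!: prod.cong)
  finally have "int (card {T \<in> reduced n a. collides s s' T}) \<le>
    int (\<Prod>(i, j)\<in>pairs n. if s i * s j = s' i * s' j then nat (a j - a i) else 2)"
    by (simp only: of_nat_le_iff)
  also have "\<dots> = (\<Prod>(i, j)\<in>pairs n. if s i * s j = s' i * s' j then a j - a i else 2)"
    unfolding of_nat_prod
    by (rule prod.cong) (use gap_pos in \<open>auto simp: pairs_def less_imp_le\<close>)
  finally show ?thesis .
qed

text \<open>
  If \<open>s\<close> and \<open>s'\<close> differ at \<open>n\<close>, the pair \<open>(1, n)\<close> will do. Otherwise they differ at some
  \<open>k\<close> strictly between \<open>1\<close> and \<open>n\<close>, both \<open>(1, k)\<close> and \<open>(k, n)\<close> separate them, and the larger of the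
  two gaps is at least half of \<open>a\<^sub>n - a\<^sub>1\<close>.
\<close>

lemma wide_separating_pair:
  assumes s: "s \<in> sign_choices n" "s' \<in> sign_choices n" "s \<noteq> s'"
  shows "\<exists>i j. (i, j) \<in> pairs n \<and> s i * s j \<noteq> s' i * s' j \<and> a n - a 1 \<le> 2 * (a j - a i)"
proof -
  obtain k where k: "k \<in> {1..n}" "s k \<noteq> s' k"
    using s PiE_ext unfolding sign_choices_def by metis
  have one: "s 1 = 1" "s' 1 = 1"
    using sign_choices_first s(1,2) k(1) by auto
  have "k \<noteq> 1" using k one by auto
  then have k1: "1 < k" "k \<le> n" using k by auto
  have nz: "s n \<noteq> 0"
    using sign_vectorD[OF sign_choices_sign_vector[OF s(1)], of n] k1 by auto
  consider "s n \<noteq> s' n" | "s n = s' n" "a n - a 1 \<le> 2 * (a k - a 1)" | "s n = s' n" "a n - a 1 \<le> 2 * (a n - a k)"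
    by (cases "s n = s' n") (auto, linarith)
  then show ?thesis
  proof cases
    case 1
    then show ?thesis using k1 one gap_pos[of 1 n]
      by (intro exI[of _ 1] exI[of _ n]) (auto simp: pairs_def)
  next
    case 2
    then show ?thesis using k1 one k by (intro exI[of _ 1] exI[of _ k]) (auto simp: pairs_def)
  next
    case 3
    then have "k \<noteq> n" using k by auto
    then show ?thesis using 3 k1 k nz by (intro exI[of _ k] exI[of _ n]) (auto simp: pairs_def)
  qed
qed

text \<open>
  In the bound for the number of collisions each factor is at most \<open>2 (a\<^sub>j - a\<^sub>i)\<close>, and at the wide pair
  the factor \<open>2\<close> stands in place of at least \<open>(a\<^sub>n - a\<^sub>1) / 2\<close>.
\<close>

lemma card_collisions_spread:
  assumes s: "s \<in> sign_choices n" "s' \<in> sign_choices n" "s \<noteq> s'"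
  shows "int (card {T \<in> reduced n a. collides s s' T}) * (a n - a 1) \<le> 2 * 2 ^ card (pairs n) * Delta n a"
proof -
  obtain p q where pq: "(p, q) \<in> pairs n" "s p * s q \<noteq> s' p * s' q" "a n - a 1 \<le> 2 * (a q - a p)"
    using wide_separating_pair[OF s] by blast
  define c where "c = (\<lambda>(i, j). if s i * s j = s' i * s' j then a j - a i else 2)"
  define d where "d = (\<lambda>(i, j). a j - a i)"
  have d_pos: "d x > 0" if "x \<in> pairs n" for x
    using that gap_pos by (auto simp: pairs_def d_def)
  have c: "0 \<le> c x" "c x \<le> 2 * d x" if "x \<in> pairs n" for x
    using d_pos[OF that] by (auto simp: c_def d_def split: if_splits prod.splits)
  define rest where "rest = (\<Prod>x\<in>pairs n - {(p, q)}. 2 * d x)"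
  have "rest \<ge> 0" unfolding rest_def by (rule prod_nonneg) (use d_pos in force)
  have "int (card {T \<in> reduced n a. collides s s' T}) \<le> (\<Prod>x\<in>pairs n. c x)"
    using card_collisions[OF sign_choices_sign_vector[OF s(1)] sign_choices_sign_vector[OF s(2)]]
    by (simp add: c_def)
  also have "(\<Prod>x\<in>pairs n. c x) = c (p, q) * (\<Prod>x\<in>pairs n - {(p, q)}. c x)"
    using pq(1) by (simp add: prod.remove)
  also have "\<dots> = 2 * (\<Prod>x\<in>pairs n - {(p, q)}. c x)" using pq(2) by (simp add: c_def)
  also have "\<dots> \<le> 2 * rest"
    unfolding rest_def using c by (intro mult_left_mono prod_mono) auto
  finally have bound: "int (card {T \<in> reduced n a. collides s s' T}) \<le> 2 * rest" .
  have "a 1 \<le> a n"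
    using pq(1) gap_pos[of 1 n] by (auto simp: pairs_def)
  then have "int (card {T \<in> reduced n a. collides s s' T}) * (a n - a 1) \<le> 2 * rest * (a n - a 1)"
    using bound by (intro mult_right_mono) auto
  also have "\<dots> \<le> 2 * rest * (2 * d (p, q))"
    using pq(3) \<open>rest \<ge> 0\<close> by (intro mult_left_mono) (auto simp: d_def)
  also have "\<dots> = 2 * (\<Prod>x\<in>pairs n. 2 * d x)"
    using pq(1) by (simp add: rest_def prod.remove)
  also have "(\<Prod>x\<in>pairs n. 2 * d x) = 2 ^ card (pairs n) * Delta n a"
    by (simp add: prod.distrib d_def Delta_pairs)
  finally show ?thesis by simp
qed

definition degenerate :: "(nat \<Rightarrow> nat \<Rightarrow> int) set" where
  "degenerate = {T \<in> reduced n a. \<exists>s\<in>sign_choices n. \<exists>s'\<in>sign_choices n. s \<noteq> s' \<and> collides s s' T}"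

text \<open>
  There are at most \<open>4\<^bsup>n-1\<^esup>\<close> pairs of sign vectors.
\<close>

lemma card_degenerate:
  assumes "n \<ge> 1"
  shows "int (card degenerate) * (a n - a 1) \<le> 4 ^ (n - 1) * (2 * 2 ^ card (pairs n)) * Delta n a"
proof -
  define D where "D = {(s, s') \<in> sign_choices n \<times> sign_choices n. s \<noteq> s'}"
  have finD: "finite D"
    unfolding D_def by (rule finite_subset[of _ "sign_choices n \<times> sign_choices n"]) (auto simp: finite_sign_choices)
  have a1n: "a 1 \<le> a n" using gap_pos[of 1 n] assms by (cases "n = 1") auto
  have "card D \<le> card (sign_choices n \<times> sign_choices n)"
    unfolding D_def by (rule card_mono) (auto simp: finite_sign_choices)
  also have "\<dots> = 4 ^ (n - 1)"
    using card_sign_choices[OF assms] by (simp add: card_cartesian_product flip: power_mult_distrib)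
  finally have cardD: "card D \<le> 4 ^ (n - 1)" .
  have "degenerate \<subseteq> (\<Union>(s, s')\<in>D. {T \<in> reduced n a. collides s s' T})" by (auto simp: degenerate_def D_def)
  then have "card degenerate \<le> card (\<Union>(s, s')\<in>D. {T \<in> reduced n a. collides s s' T})"
    using finD finite_reduced by (intro card_mono) auto
  also have "\<dots> \<le> (\<Sum>(s, s')\<in>D. card {T \<in> reduced n a. collides s s' T})"
    using card_UN_le[OF finD, of "\<lambda>(s, s'). {T \<in> reduced n a. collides s s' T}"]
    by (simp add: case_prod_beta)
  finally have "int (card degenerate) \<le> (\<Sum>(s, s')\<in>D. int (card {T \<in> reduced n a. collides s s' T}))"
    by (simp add: case_prod_beta flip: of_nat_sum)
  then have "int (card degenerate) * (a n - a 1) \<le>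
      (\<Sum>(s, s')\<in>D. int (card {T \<in> reduced n a. collides s s' T})) * (a n - a 1)"
    using a1n by (intro mult_right_mono) auto
  also have "\<dots> = (\<Sum>(s, s')\<in>D. int (card {T \<in> reduced n a. collides s s' T}) * (a n - a 1))"
    by (simp add: sum_distrib_right case_prod_beta)
  also have "\<dots> \<le> (\<Sum>(s, s')\<in>D. 2 * 2 ^ card (pairs n) * Delta n a)"
    by (rule sum_mono) (use card_collisions_spread in \<open>auto simp: D_def simp del: One_nat_def\<close>)
  also have "\<dots> = int (card D) * (2 * 2 ^ card (pairs n) * Delta n a)" by (simp add: case_prod_beta)
  also have "\<dots> \<le> 4 ^ (n - 1) * (2 * 2 ^ card (pairs n) * Delta n a)"
  proof (rule mult_right_mono)
    show "int (card D) \<le> 4 ^ (n - 1)" using cardD by (metis of_nat_le_iff of_nat_power of_nat_numeral)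
    show "0 \<le> 2 * 2 ^ card (pairs n) * Delta n a" by (simp flip: card_reduced)
  qed
  finally show ?thesis by (simp add: mult.assoc)
qed

lemma Delta_le_power:
  assumes "n \<ge> 1"
  shows "Delta n a \<le> (a n - a 1) ^ card (pairs n)"
proof -
  have mono: "a i \<le> a j" if "1 \<le> i" "i \<le> j" "j \<le> n" for i j
    using gap_pos[of i j] that by (cases "i = j") auto
  have "Delta n a \<le> (\<Prod>x\<in>pairs n. a n - a 1)"
    unfolding Delta_pairs
  proof (rule prod_mono)
    fix x assume "x \<in> pairs n"
    then obtain i j where x: "x = (i, j)" "1 \<le> i" "i < j" "j \<le> n" by (auto simp: pairs_def)
    then show "0 \<le> (case x of (i, j) \<Rightarrow> a j - a i) \<and> (case x of (i, j) \<Rightarrow> a j - a i) \<le> a n - a 1"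
      using mono[of i j] mono[of 1 i] mono[of j n] by auto
  qed
  then show ?thesis by simp
qed

lemma equiv_fractional_ideals:
  "equiv {I. fractional_ideal (chi n a) I} (fractional_ideal_equiv (chi n a))"
proof (rule equivI)
  have scale_id: "scale (\<lambda>_. 1) L = L" for L by (simp add: scale_def)
  have scale_scale: "scale d (scale e L) = scale (\<lambda>i. d i * e i) L" for d e L
    by (simp add: scale_def image_image mult.assoc)
  show "fractional_ideal_equiv (chi n a) \<subseteq> {I. fractional_ideal (chi n a) I} \<times> {I. fractional_ideal (chi n a) I}"
    by (auto simp: fractional_ideal_equiv_def)
  show "refl_on {I. fractional_ideal (chi n a) I} (fractional_ideal_equiv (chi n a))"
    by (intro refl_onI) (auto simp: equiv_iff_scale scale_id intro!: exI[of _ "\<lambda>_. 1"])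
  show "sym (fractional_ideal_equiv (chi n a))"
  proof (rule symI)
    fix I J assume "(I, J) \<in> fractional_ideal_equiv (chi n a)"
    then obtain d where IJ: "fractional_ideal (chi n a) I" "fractional_ideal (chi n a) J"
      and d: "\<forall>i\<in>{1..n}. d i \<noteq> 0" "coords ` I = scale d (coords ` J)"
      unfolding equiv_iff_scale by blast
    have "(\<lambda>v i. inverse (d i) * d i * v i) ` coords ` J = id ` coords ` J"
    proof (rule image_cong)
      fix v assume v: "v \<in> coords ` J"
      have "inverse (d i) * d i * v i = v i" for i
      proof (cases "i \<in> {1..n}")
        case False
        then show ?thesis using v coords_outside fractional_ideal_has_type(1)[OF IJ(2)] by auto
      qed (use d(1) in auto)
      then show "(\<lambda>i. inverse (d i) * d i * v i) = id v" by (simp only: id_apply)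
    qed simp
    then have "scale (\<lambda>i. inverse (d i)) (coords ` I) = coords ` J"
      unfolding d(2) scale_scale by (simp add: scale_def)
    then show "(J, I) \<in> fractional_ideal_equiv (chi n a)"
      using IJ d(1) unfolding equiv_iff_scale by (auto intro!: exI[of _ "\<lambda>i. inverse (d i)"])
  qed
  show "trans (fractional_ideal_equiv (chi n a))"
  proof (rule transI)
    fix I J H assume "(I, J) \<in> fractional_ideal_equiv (chi n a)" "(J, H) \<in> fractional_ideal_equiv (chi n a)"
    then obtain d e where "fractional_ideal (chi n a) I" "fractional_ideal (chi n a) H"
      and "\<forall>i\<in>{1..n}. d i \<noteq> 0" "coords ` I = scale d (coords ` J)"
      and "\<forall>i\<in>{1..n}. e i \<noteq> 0" "coords ` J = scale e (coords ` H)"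
      unfolding equiv_iff_scale by blast
    then show "(I, H) \<in> fractional_ideal_equiv (chi n a)"
      unfolding equiv_iff_scale by (auto simp: scale_scale intro!: exI[of _ "\<lambda>i. d i * e i"])
  qed
qed

definition ideal_of_type :: "(nat \<Rightarrow> nat \<Rightarrow> int) \<Rightarrow> rat poly set set" where
  "ideal_of_type T = (SOME I. fractional_ideal (chi n a) I \<and> has_type n a (coords ` I) T)"

lemma ideal_of_type:
  assumes "T \<in> reduced n a"
  shows "fractional_ideal (chi n a) (ideal_of_type T)" "has_type n a (coords ` ideal_of_type T) T"
proof -
  obtain L where L: "has_type n a L T" using type_has_lattice[OF reduced_has_diag[OF assms]] by blast
  obtain I where "fractional_ideal (chi n a) I" "coords ` I = L"
    using lattice_is_fractional_ideal[OF L] by blast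
  then have "\<exists>I. fractional_ideal (chi n a) I \<and> has_type n a (coords ` I) T" using L by blast
  from someI_ex[OF this] show "fractional_ideal (chi n a) (ideal_of_type T)"
    "has_type n a (coords ` ideal_of_type T) T" unfolding ideal_of_type_def by blast+
qed

lemma equiv_iff_conj:
  assumes "fractional_ideal (chi n a) I" "has_type n a (coords ` I) T"
    and "fractional_ideal (chi n a) J" "has_type n a (coords ` J) T'" "has_diag n a T'"
  shows "(I, J) \<in> fractional_ideal_equiv (chi n a) \<longleftrightarrow>
    (\<exists>g. sign_vector n (\<lambda>i. g i i) \<and> conj_via n T g T')"
  using assms scale_equivalent_iff_conj[of "coords ` I" T "coords ` J" T'] unfolding equiv_iff_scale by blast

definition class_of_type :: "(nat \<Rightarrow> nat \<Rightarrow> int) \<Rightarrow> rat poly set set set" where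
  "class_of_type T = fractional_ideal_equiv (chi n a) `` {ideal_of_type T}"

lemma class_of_type_eq_iff:
  assumes T: "T \<in> reduced n a" and S: "S \<in> reduced n a"
  shows "class_of_type T = class_of_type S \<longleftrightarrow> (\<exists>g. sign_vector n (\<lambda>i. g i i) \<and> conj_via n T g S)"
proof -
  have "class_of_type T = class_of_type S \<longleftrightarrow>
      (ideal_of_type T, ideal_of_type S) \<in> fractional_ideal_equiv (chi n a)"
    unfolding class_of_type_def
    by (rule eq_equiv_class_iff[OF equiv_fractional_ideals]) (use T S ideal_of_type in auto)
  also have "\<dots> \<longleftrightarrow> (\<exists>g. sign_vector n (\<lambda>i. g i i) \<and> conj_via n T g S)"
    by (rule equiv_iff_conj) (use T S ideal_of_type reduced_has_diag in auto)
  finally show ?thesis .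
qed

lemma carrier_ICM: "carrier (ICM (chi n a)) = class_of_type ` reduced n a"
proof -
  let ?E = "fractional_ideal_equiv (chi n a)"
  have "\<exists>T\<in>reduced n a. ?E `` {I} = class_of_type T" if I: "fractional_ideal (chi n a) I" for I
  proof -
    obtain T where T: "T \<in> reduced n a" "has_type n a (coords ` I) T"
      using fractional_ideal_has_type(2)[OF I] by blast
    have "conj_via n T (\<lambda>i j. if i = j then 1 else 0) T"
      unfolding conj_via_iff[OF reduced_has_diag[OF T(1)] reduced_has_diag[OF T(1)]] by auto
    moreover have "sign_vector n (\<lambda>i. if i = i then 1 else 0)" by (simp add: sign_vector_def)
    ultimately have "\<exists>g. sign_vector n (\<lambda>i. g i i) \<and> conj_via n T g T"
      by (intro exI[of _ "\<lambda>i j. if i = j then 1 else 0"]) auto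
    then have "(I, ideal_of_type T) \<in> ?E"
      using equiv_iff_conj[OF I T(2) ideal_of_type[OF T(1)] reduced_has_diag[OF T(1)]] by blast
    then have "?E `` {I} = class_of_type T"
      unfolding class_of_type_def by (rule equiv_class_eq[OF equiv_fractional_ideals])
    then show ?thesis using T(1) by blast
  qed
  moreover have "class_of_type T \<in> {I. fractional_ideal (chi n a) I} // ?E" if "T \<in> reduced n a" for T
    unfolding class_of_type_def by (rule quotientI) (use ideal_of_type(1)[OF that] in simp)
  ultimately have "{I. fractional_ideal (chi n a) I} // ?E = class_of_type ` reduced n a"
    by (fastforce elim!: quotientE)
  then show ?thesis by (simp add: ICM_def)
qed

definition normal_form :: "(nat \<Rightarrow> nat \<Rightarrow> int) \<Rightarrow> (nat \<Rightarrow> int) \<Rightarrow> nat \<Rightarrow> nat \<Rightarrow> int" where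
  "normal_form T s = (SOME U. U \<in> reduced n a \<and> (\<exists>g. (\<forall>i\<in>{1..n}. g i i = s i) \<and> conj_via n T g U))"

lemma normal_form:
  assumes "T \<in> reduced n a" "sign_vector n s"
  shows "normal_form T s \<in> reduced n a"
    and "\<exists>g. (\<forall>i\<in>{1..n}. g i i = s i) \<and> conj_via n T g (normal_form T s)"
proof -
  have "\<exists>U. U \<in> reduced n a \<and> (\<exists>g. (\<forall>i\<in>{1..n}. g i i = s i) \<and> conj_via n T g U)"
    using normal_form_exists[OF reduced_has_diag[OF assms(1)] assms(2)] by blast
  from someI_ex[OF this] show "normal_form T s \<in> reduced n a"
    "\<exists>g. (\<forall>i\<in>{1..n}. g i i = s i) \<and> conj_via n T g (normal_form T s)"
    unfolding normal_form_def by blast+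
qed

text \<open>
  A class is an orbit: from \<open>T g = g S\<close> with a sign vector as diagonal of \<open>g\<close>, the matrix \<open>g\<^sub>1\<^sub>1 g\<close> has
  an admissible diagonal \<open>s\<close> and still conjugates \<open>T\<close> to \<open>S\<close>, so \<open>S\<close> is the normal form of \<open>T\<close> for
  \<open>s\<close>.
\<close>

lemma class_fibre:
  assumes T: "T \<in> reduced n a"
  shows "{S \<in> reduced n a. class_of_type S = class_of_type T} = normal_form T ` sign_choices n"
proof (intro equalityI subsetI)
  fix S assume "S \<in> normal_form T ` sign_choices n"
  then obtain s where s: "s \<in> sign_choices n" "S = normal_form T s" by blast
  have sv: "sign_vector n s" by (rule sign_choices_sign_vector[OF s(1)])
  obtain g where g: "\<forall>i\<in>{1..n}. g i i = s i" "conj_via n T g S"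
    using normal_form(2)[OF T sv] s(2) by blast
  have S: "S \<in> reduced n a" using normal_form(1)[OF T sv] s(2) by simp
  have "sign_vector n (\<lambda>i. g i i)" using sv g(1) by (simp add: sign_vector_def)
  then show "S \<in> {S \<in> reduced n a. class_of_type S = class_of_type T}"
    using class_of_type_eq_iff[OF T S] g(2) S by auto
next
  fix S assume "S \<in> {S \<in> reduced n a. class_of_type S = class_of_type T}"
  then have S: "S \<in> reduced n a" and "class_of_type T = class_of_type S" by auto
  then obtain g where g: "sign_vector n (\<lambda>i. g i i)" "conj_via n T g S"
    using class_of_type_eq_iff[OF T S] by blast
  define h where "h i j = g 1 1 * g i j" for i j
  define s where "s = restrict (\<lambda>i. h i i) {1..n}"
  have h1: "g 1 1 * g 1 1 = 1" if "n \<ge> 1" using sign_vectorD[OF g(1), of 1] that by auto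
  have hs: "sign_vector n (\<lambda>i. h i i)"
    unfolding sign_vector_def
  proof
    fix i assume i: "i \<in> {1..n}"
    then show "h i i = 1 \<or> h i i = - 1"
      using sign_vectorD[OF g(1), of 1] sign_vectorD[OF g(1), of i] by (auto simp: h_def)
  qed
  have s: "s \<in> sign_choices n"
    unfolding sign_choices_def s_def
  proof (rule restrict_PiE_iff[THEN iffD2], rule ballI)
    fix i assume "i \<in> {1..n}"
    then show "h i i \<in> (if i = 1 then {1} else {1, - 1})"
      using sign_vectorD[OF hs, of i] h1 by (auto simp: h_def)
  qed
  have "(T \<diamondop> h) i j = g 1 1 * (T \<diamondop> g) i j" "(h \<diamondop> S) i j = g 1 1 * (g \<diamondop> S) i j" for i j
    by (simp_all add: tri_mult_def h_def sum_distrib_left mult.assoc mult.left_commute)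
  then have hconj: "conj_via n T h S" using g(2) by (simp add: conj_via_def)
  obtain f where f: "\<forall>i\<in>{1..n}. f i i = s i" "conj_via n T f (normal_form T s)"
    using normal_form(2)[OF T sign_choices_sign_vector[OF s]] by blast
  have "S = normal_form T s"
    by (rule normal_form_unique[OF reduced_has_diag[OF T] sign_choices_sign_vector[OF s] S _ hconj
          normal_form(1)[OF T sign_choices_sign_vector[OF s]] f]) (simp add: s_def)
  then show "S \<in> normal_form T ` sign_choices n" using s by blast
qed

lemma normal_form_inj:
  assumes T: "T \<in> reduced n a - degenerate"
  shows "inj_on (normal_form T) (sign_choices n)"
proof (rule inj_onI, rule ccontr)
  fix s s' assume s: "s \<in> sign_choices n" "s' \<in> sign_choices n" and eq: "normal_form T s = normal_form T s'"
    and ne: "s \<noteq> s'"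
  have TR: "T \<in> reduced n a" using T by simp
  note nf = normal_form[OF TR sign_choices_sign_vector[OF s(1)]] normal_form[OF TR sign_choices_sign_vector[OF s(2)]]
  have "collides s s' T"
    unfolding collides_def using nf eq by metis
  then show False using T s ne unfolding degenerate_def by blast
qed

lemma class_number_bounds:
  assumes "n \<ge> 1"
  defines "C \<equiv> card (carrier (ICM (chi n a)))"
  shows "Delta n a \<le> 2 ^ (n - 1) * int C"
    and "2 ^ (n - 1) * int C \<le> Delta n a + 2 ^ (n - 1) * int (card degenerate)"
proof -
  have le: "card {S \<in> reduced n a. class_of_type S = class_of_type T} \<le> 2 ^ (n - 1)" if "T \<in> reduced n a" for T
    unfolding class_fibre[OF that] card_sign_choices[OF assms(1), symmetric]
    by (rule card_image_le[OF finite_sign_choices])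
  have eq: "card {S \<in> reduced n a. class_of_type S = class_of_type T} = 2 ^ (n - 1)"
    if "T \<in> reduced n a - degenerate" for T
    using card_image[OF normal_form_inj[OF that]] class_fibre[of T] that card_sign_choices[OF assms(1)] by simp
  have "degenerate \<subseteq> reduced n a" by (auto simp: degenerate_def)
  note fibre_count_bounds[where F = class_of_type, OF finite_reduced this le eq]
  then have bounds: "card (reduced n a) \<le> 2 ^ (n - 1) * C"
      "2 ^ (n - 1) * C \<le> card (reduced n a) + 2 ^ (n - 1) * card degenerate"
    unfolding C_def carrier_ICM by blast+
  have "int (card (reduced n a)) \<le> int (2 ^ (n - 1) * C)" using bounds(1) by (simp only: of_nat_le_iff)
  then show "Delta n a \<le> 2 ^ (n - 1) * int C" by (simp add: card_reduced)
  have "int (2 ^ (n - 1) * C) \<le> int (card (reduced n a) + 2 ^ (n - 1) * card degenerate)"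
    using bounds(2) by (simp only: of_nat_le_iff)
  then show "2 ^ (n - 1) * int C \<le> Delta n a + 2 ^ (n - 1) * int (card degenerate)"
    by (simp add: card_reduced)
qed

lemma class_number_error:
  assumes n: "n \<ge> 1" and spread: "a 1 < a n"
  shows "\<bar>real (card (carrier (ICM (chi n a)))) * 2 ^ (n - 1) / real_of_int (Delta n a) - 1\<bar> \<le>
    2 ^ (n - 1) * (4 ^ (n - 1) * (2 * 2 ^ card (pairs n))) / real_of_int (a n - a 1)"
proof -
  define C where "C = real (card (carrier (ICM (chi n a))))"
  define D where "D = real_of_int (Delta n a)"
  define M where "M = real_of_int (a n - a 1)"
  define k :: real where "k = 4 ^ (n - 1) * (2 * 2 ^ card (pairs n))"
  have D: "D > 0"
    unfolding D_def Delta_pairs of_int_0_less_iff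
    by (rule prod_pos) (use gap_pos in \<open>auto simp: pairs_def\<close>)
  have M: "M > 0" using spread by (simp add: M_def)
  have "real_of_int (Delta n a) \<le> real_of_int (2 ^ (n - 1) * int (card (carrier (ICM (chi n a)))))"
    using class_number_bounds(1)[OF n] by (simp only: of_int_le_iff)
  then have lower: "D \<le> C * 2 ^ (n - 1)" by (simp add: C_def D_def mult.commute)
  have "real_of_int (2 ^ (n - 1) * int (card (carrier (ICM (chi n a))))) \<le>
      real_of_int (Delta n a + 2 ^ (n - 1) * int (card degenerate))"
    using class_number_bounds(2)[OF n] by (simp only: of_int_le_iff)
  then have upper: "C * 2 ^ (n - 1) \<le> D + 2 ^ (n - 1) * real (card degenerate)"
    by (simp add: C_def D_def mult.commute)
  have "real_of_int (int (card degenerate) * (a n - a 1)) \<le>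
      real_of_int (4 ^ (n - 1) * (2 * 2 ^ card (pairs n)) * Delta n a)"
    using card_degenerate[OF n] by (simp only: of_int_le_iff)
  then have "real (card degenerate) * M \<le> k * D" by (simp add: M_def D_def k_def)
  then have "real (card degenerate) \<le> k * D / M" using M by (simp add: pos_le_divide_eq)
  then have "2 ^ (n - 1) * real (card degenerate) \<le> 2 ^ (n - 1) * (k * D / M)" by (intro mult_left_mono) auto
  with upper have "C * 2 ^ (n - 1) - D \<le> 2 ^ (n - 1) * k / M * D" by simp
  then have "(C * 2 ^ (n - 1) - D) / D \<le> 2 ^ (n - 1) * k / M" using D by (simp add: pos_divide_le_eq)
  moreover have "(C * 2 ^ (n - 1) - D) / D = C * 2 ^ (n - 1) / D - 1" using D by (simp add: diff_divide_distrib)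
  moreover have "0 \<le> (C * 2 ^ (n - 1) - D) / D" using lower D by simp
  ultimately have "\<bar>C * 2 ^ (n - 1) / D - 1\<bar> \<le> 2 ^ (n - 1) * k / M" by simp
  then show ?thesis by (simp add: C_def D_def M_def k_def)
qed

end

theorem theorem1p3:
  fixes n :: nat
  assumes "n \<ge> 1"
  shows "\<forall>\<epsilon>::real. \<epsilon> > 0 \<longrightarrow>
    (\<exists>N::int. \<forall>a :: nat \<Rightarrow> int. strict_mono_on {1..n} a \<longrightarrow> Delta n a \<ge> N \<longrightarrow>
       \<bar>real (card (carrier (ICM (chi n a)))) * 2 ^ (n - 1) / real_of_int (Delta n a) - 1\<bar> < \<epsilon>)"
proof (intro allI impI)
  fix \<epsilon> :: real assume \<epsilon>: "\<epsilon> > 0"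
  define c :: real where "c = 2 ^ (n - 1) * (4 ^ (n - 1) * (2 * 2 ^ card (pairs n)))"
  define m where "m = \<lceil>c / \<epsilon>\<rceil>"
  have "c > 0" by (simp add: c_def)
  then have m: "m > 0" "c / \<epsilon> \<le> m" using \<epsilon> by (auto simp: m_def)
  \<comment> \<open>\<open>m\<close> is how large \<open>a n - a 1\<close> has to be; \<open>\<Delta> > m ^ card (pairs n)\<close> forces this.\<close>
  show "\<exists>N::int. \<forall>a. strict_mono_on {1..n} a \<longrightarrow> Delta n a \<ge> N \<longrightarrow>
    \<bar>real (card (carrier (ICM (chi n a)))) * 2 ^ (n - 1) / real_of_int (Delta n a) - 1\<bar> < \<epsilon>"
  proof (intro exI[of _ "m ^ card (pairs n) + 1"] allI impI)
    fix a :: "nat \<Rightarrow> int"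
    assume "strict_mono_on {1..n} a" and large: "m ^ card (pairs n) + 1 \<le> Delta n a"
    then interpret increasing_roots n a by unfold_locales
    have spread: "m < a n - a 1"
    proof (rule ccontr)
      assume "\<not> m < a n - a 1"
      moreover have "0 \<le> a n - a 1" using gap_pos[of 1 n] assms by (cases "n = 1") auto
      ultimately have "(a n - a 1) ^ card (pairs n) \<le> m ^ card (pairs n)" by (intro power_mono) auto
      then show False using Delta_le_power[OF assms] large by simp
    qed
    then have "c / \<epsilon> < real_of_int (a n - a 1)" using m(2) by linarith
    moreover have "0 < real_of_int (a n - a 1)" using spread m(1) by simp
    ultimately have "c / real_of_int (a n - a 1) < \<epsilon>"
      using \<epsilon> by (simp add: pos_divide_less_eq mult.commute)
    then show "\<bar>real (card (carrier (ICM (chi n a)))) * 2 ^ (n - 1) / real_of_int (Delta n a) - 1\<bar> < \<epsilon>"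
      using class_number_error[OF assms] spread m(1) by (simp add: c_def)
  qed
qed

end
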